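(* There exist a function $f\in H^\infty(\mathbb T^\infty)$ with boundary values $f^*\neq 0$ $m_\infty$-almost everywhere on $\mathbb T^\infty$, and a sequence of Borel measurable maps $r^{(s)}:\mathbb T^\infty\to c_0\cap[0,1)^\infty$, $s\ge 1$, such that, for $m_\infty$-almost every $e^{i\theta}\in\mathbb T^\infty$, the vectors $r^{(s)}(\theta)=\bigl(r^{(s)}_n(\theta)\bigr)_{n\ge1}$ have the following properties: (1) $r^{(s)}_1(\theta)\ge r^{(s)}_2(\theta)\ge\cdots$ for every $s\ge1$; (2) $r^{(s)}_n(\theta)\le r^{(s+1)}_n(\theta)$ for all $n,s\ge1$, and $r^{(s)}_n(\theta)\to 1$ as $s\to\infty$ for every $n\ge1$; (3) $f\bigl(r^{(s)}(\theta)e^{i\theta}\bigr)\to 0$ as $s\to\infty$.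
   Context: $\mathbb T$ is the unit circle with normalized Haar measure $m$, $\mathbb D$ is the open unit disc, $\mathbb T^\infty=\prod_{n\ge1}\mathbb T$, $\mathbb D^\infty=\prod_{n\ge1}\mathbb D$, and $m_\infty=\bigotimes_{n\ge1}m$ is the product probability measure on $\mathbb T^\infty$. $c_0$ is the Banach space (sup norm) of complex sequences $(z_n)_{n\ge1}$ with $z_n\to0$. For $\theta=(\theta_n)$ and $r=(r_n)\in[0,1)^\infty$, write $e^{i\theta}=(e^{i\theta_n})_{n\ge1}\in\mathbb T^\infty$ and $re^{i\theta}=(r_ne^{i\theta_n})_{n\ge1}$; a function of $e^{i\theta}\in\mathbb T^\infty$ is also written as a function of $\theta$. $H^\infty(\mathbb T^\infty)$ is the subspace of those $g\in L^\infty(\mathbb T^\infty,m_\infty)$ whose Fourier coefficients $\hat g(\gamma)=\int_{\mathbb T^\infty} g(w)\overline{w^\gamma}\,dm_\infty(w)$, indexed by finitely supported $\gamma\in\mathbb Z^{\infty}$ with $w^\gamma=\prod_n w_n^{\gamma_n}$, vanish unless all $\gamma_n\ge0$. Each $g\in H^\infty(\mathbb T^\infty)$ has a unique bounded holomorphic extension to $c_0\cap\mathbb D^\infty$ (the open unit ball of $c_0$), namely the bounded holomorphic function on $c_0\cap\mathbb D^\infty$ whose monomial coefficients (computed on finitely supported points) are the Fourier coefficients $\hat g(\alpha)$, $\alpha\ge0$ finitely supported; this correspondence is an isometric bijection onto the bounded holomorphic functions on $c_0\cap\mathbb D^\infty$. The same symbol $f$ is used for the holomorphic extension, and $f^*$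 denotes the boundary function, i.e. the element of $L^\infty(\mathbb T^\infty)$ itself. *)

theory Defs
  imports "HOL-Probability.Probability" "HOL-Library.Poly_Mapping"
begin

section \<open>The Banach space of null sequences\<close>

text \<open>Sequences are indexed from \<open>0\<close> instead of \<open>1\<close> throughout.\<close>

typedef (overloaded) ('a::real_normed_vector) c0 = "{x :: nat \<Rightarrow> 'a. x \<longlonglongrightarrow> 0}"
  morphisms coord Abs_c0
  by (rule exI[of _ "\<lambda>_. 0"]) simp

setup_lifting type_definition_c0

lemma coord_tendsto_0: "coord x \<longlonglongrightarrow> 0"
  using coord[of x] by simp

lemma c0_eqI: "(\<And>n. coord x n = coord y n) \<Longrightarrow> x = y"
  by (simp add: coord_inject[symmetric] fun_eq_iff)

lemma bdd_above_norm_coord: "bdd_above (range (\<lambda>n. norm (coord x n)))"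
proof -
  have "Bseq (coord x)"
    using coord_tendsto_0 by (blast intro: convergent_imp_Bseq convergentI)
  then show ?thesis
    unfolding Bseq_def by (auto simp: bdd_above_def)
qed

instantiation c0 :: (real_normed_vector) real_vector
begin

lift_definition zero_c0 :: "'a c0" is "\<lambda>_. 0" by simp
lift_definition plus_c0 :: "'a c0 \<Rightarrow> 'a c0 \<Rightarrow> 'a c0" is "\<lambda>x y n. x n + y n"
  using tendsto_add_zero by blast
lift_definition uminus_c0 :: "'a c0 \<Rightarrow> 'a c0" is "\<lambda>x n. - x n"
  using tendsto_minus by fastforce
lift_definition minus_c0 :: "'a c0 \<Rightarrow> 'a c0 \<Rightarrow> 'a c0" is "\<lambda>x y n. x n - y n"
  using tendsto_diff by fastforce
lift_definition scaleR_c0 :: "real \<Rightarrow> 'a c0 \<Rightarrow> 'a c0" is "\<lambda>c x n. c *\<^sub>R x n"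
  using tendsto_scaleR[OF tendsto_const] by fastforce

instance
  by standard (rule c0_eqI; simp add: plus_c0.rep_eq zero_c0.rep_eq uminus_c0.rep_eq
      minus_c0.rep_eq scaleR_c0.rep_eq algebra_simps)+

end

instantiation c0 :: (real_normed_vector) real_normed_vector
begin

definition norm_c0 :: "'a c0 \<Rightarrow> real" where
  "norm_c0 x = (SUP n. norm (coord x n))"
definition dist_c0 :: "'a c0 \<Rightarrow> 'a c0 \<Rightarrow> real" where
  "dist_c0 x y = norm (x - y)"
definition sgn_c0 :: "'a c0 \<Rightarrow> 'a c0" where
  "sgn_c0 x = inverse (norm x) *\<^sub>R x"
definition uniformity_c0 :: "('a c0 \<times> 'a c0) filter" where
  "uniformity_c0 = (INF e\<in>{0<..}. principal {(x, y). dist x y < e})"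
definition open_c0 :: "'a c0 set \<Rightarrow> bool" where
  "open_c0 U = (\<forall>x\<in>U. eventually (\<lambda>(x', y). x' = x \<longrightarrow> y \<in> U) uniformity)"

instance
proof
  fix x y :: "'a c0" and a :: real
  have le: "norm (coord u n) \<le> norm u" for u :: "'a c0" and n
    unfolding norm_c0_def by (rule cSUP_upper[OF UNIV_I bdd_above_norm_coord])
  show "dist x y = norm (x - y)" by (rule dist_c0_def)
  show "sgn x = x /\<^sub>R norm x" by (simp add: sgn_c0_def)
  show "uniformity = (INF e\<in>{0<..}. principal {(x :: 'a c0, y). dist x y < e})"
    by (rule uniformity_c0_def)
  show "open U = (\<forall>x\<in>U. \<forall>\<^sub>F (x', y) in uniformity. x' = x \<longrightarrow> y \<in> U)" for U :: "'a c0 set"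
    by (rule open_c0_def)
  show "norm x = 0 \<longleftrightarrow> x = 0"
  proof
    assume "norm x = 0"
    then have "coord x n = 0" for n using le[of x n] by simp
    then show "x = 0" by (intro c0_eqI) (simp add: zero_c0.rep_eq)
  next
    assume "x = 0" then show "norm x = 0"
      by (simp add: norm_c0_def zero_c0.rep_eq)
  qed
  show "norm (x + y) \<le> norm x + norm y"
    unfolding norm_c0_def[of "x + y"]
    by (rule cSUP_least)
      (auto simp: plus_c0.rep_eq intro: order_trans[OF norm_triangle_ineq] add_mono le)
  show "norm (a *\<^sub>R x) = \<bar>a\<bar> * norm x"
  proof (cases "a = 0")
    case True then show ?thesis by (simp add: norm_c0_def zero_c0.rep_eq)
  next
    case False
    have *: "norm (c *\<^sub>R u) \<le> \<bar>c\<bar> * norm u" for c and u :: "'a c0"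
      unfolding norm_c0_def[of "c *\<^sub>R u"]
      by (rule cSUP_least) (auto simp: scaleR_c0.rep_eq intro!: mult_left_mono le)
    have "x = inverse a *\<^sub>R a *\<^sub>R x"
      using False by (intro c0_eqI) (simp add: scaleR_c0.rep_eq)
    then have "norm x \<le> \<bar>inverse a\<bar> * norm (a *\<^sub>R x)" using * by metis
    then have "\<bar>a\<bar> * norm x \<le> norm (a *\<^sub>R x)" using False by (simp add: field_simps)
    with *[of a x] show ?thesis by simp
  qed
qed

end

lemma norm_coord_le: "norm (coord x n) \<le> norm x"
  unfolding norm_c0_def by (rule cSUP_upper[OF UNIV_I bdd_above_norm_coord])

lemma norm_c0_least: "(\<And>n. norm (coord x n) \<le> B) \<Longrightarrow> norm x \<le> B"
  unfolding norm_c0_def by (rule cSUP_least) auto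

instance c0 :: (banach) banach
proof
  fix X :: "nat \<Rightarrow> 'a c0"
  assume X: "Cauchy X"
  have "Cauchy (\<lambda>k. coord (X k) n)" for n
  proof (rule metric_CauchyI)
    fix e :: real assume "e > 0"
    then obtain M where M: "\<And>j k. j \<ge> M \<Longrightarrow> k \<ge> M \<Longrightarrow> dist (X j) (X k) < e"
      using metric_CauchyD[OF X] by blast
    have "dist (coord (X j) n) (coord (X k) n) < e" if "j \<ge> M" "k \<ge> M" for j k
      using norm_coord_le[of "X j - X k" n] M[OF that]
      by (simp add: dist_norm minus_c0.rep_eq)
    then show "\<exists>M. \<forall>m\<ge>M. \<forall>k\<ge>M. dist (coord (X m) n) (coord (X k) n) < e" by blast
  qed
  then have "\<forall>n. \<exists>l. (\<lambda>k. coord (X k) n) \<longlonglongrightarrow> l"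
    using Cauchy_convergent convergent_def by blast
  then obtain y where y: "\<And>n. (\<lambda>k. coord (X k) n) \<longlonglongrightarrow> y n" by metis
  have unif: "\<exists>M. \<forall>k\<ge>M. \<forall>n. norm (coord (X k) n - y n) \<le> e" if "e > 0" for e
  proof -
    obtain M where M: "\<And>j k. j \<ge> M \<Longrightarrow> k \<ge> M \<Longrightarrow> dist (X j) (X k) < e"
      using metric_CauchyD[OF X \<open>e > 0\<close>] by blast
    have "norm (coord (X k) n - y n) \<le> e" if "k \<ge> M" for k n
    proof (rule Lim_bounded)
      show "(\<lambda>j. norm (coord (X k) n - coord (X j) n)) \<longlonglongrightarrow> norm (coord (X k) n - y n)"
        by (intro tendsto_intros y)
      show "\<forall>j\<ge>M. norm (coord (X k) n - coord (X j) n) \<le> e"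
      proof (intro allI impI)
        fix j assume "j \<ge> M"
        with norm_coord_le[of "X k - X j" n] M[OF \<open>k \<ge> M\<close>, of j]
        show "norm (coord (X k) n - coord (X j) n) \<le> e"
          by (simp add: dist_norm minus_c0.rep_eq)
      qed
    qed
    then show ?thesis by blast
  qed
  have ul: "uniform_limit UNIV (\<lambda>k n. coord (X k) n) y sequentially"
  proof (rule uniform_limitI)
    fix e :: real assume "e > 0"
    then obtain M where "\<forall>k\<ge>M. \<forall>n. norm (coord (X k) n - y n) \<le> e / 2"
      using unif[of "e / 2"] by auto
    then show "\<forall>\<^sub>F k in sequentially. \<forall>n\<in>UNIV. dist (coord (X k) n) (y n) < e"
      using \<open>e > 0\<close> unfolding eventually_sequentially dist_norm
      by (intro exI[of _ M]) (auto intro: le_less_trans[of _ "e / 2"])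
  qed
  have "y \<longlonglongrightarrow> 0"
    by (rule swap_uniform_limit'[OF _ tendsto_const ul])
      (simp_all add: coord_tendsto_0 always_eventually)
  then have c: "coord (Abs_c0 y) = y" by (simp add: Abs_c0_inverse)
  have "X \<longlonglongrightarrow> Abs_c0 y"
  proof (rule metric_LIMSEQ_I)
    fix e :: real assume e: "e > 0"
    then obtain M where M: "\<forall>k\<ge>M. \<forall>n. norm (coord (X k) n - y n) \<le> e / 2"
      using unif[of "e / 2"] by auto
    have "dist (X k) (Abs_c0 y) \<le> e / 2" if "k \<ge> M" for k
      unfolding dist_norm by (rule norm_c0_least) (use M that in \<open>simp add: minus_c0.rep_eq c\<close>)
    then show "\<exists>M. \<forall>k\<ge>M. dist (X k) (Abs_c0 y) < e"
      using e by (intro exI[of _ M]) fastforce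
  qed
  then show "convergent X" by (rule convergentI)
qed

lemma ball_c0_iff: "x \<in> ball 0 1 \<longleftrightarrow> (\<forall>n. norm (coord x n) < 1)"
proof
  assume "x \<in> ball 0 1"
  then show "\<forall>n. norm (coord x n) < 1"
    using norm_coord_le[of x] by (auto intro: le_less_trans)
next
  assume *: "\<forall>n. norm (coord x n) < 1"
  have "(\<lambda>n. norm (coord x n)) \<longlonglongrightarrow> 0"
    using coord_tendsto_0[of x] tendsto_norm_zero by blast
  then obtain N where N: "\<And>n. n \<ge> N \<Longrightarrow> norm (coord x n) < 1 / 2"
    using order_tendstoD(2)[of _ 0 sequentially "1 / 2 :: real"]
    by (auto simp: eventually_sequentially)
  define B where "B = Max (insert (1 / 2) ((\<lambda>n. norm (coord x n)) ` {..<N}))"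
  have "norm (coord x n) \<le> B" for n
  proof (cases "n < N")
    case True then show ?thesis unfolding B_def by (intro Max_ge) auto
  next
    case False
    then have "norm (coord x n) \<le> 1 / 2" using N[of n] by simp
    also have "\<dots> \<le> B" unfolding B_def by (intro Max_ge) auto
    finally show ?thesis .
  qed
  then have "norm x \<le> B" by (rule norm_c0_least)
  moreover have "B < 1" unfolding B_def using * by (subst Max_less_iff) auto
  ultimately show "x \<in> ball 0 1" by simp
qed

lift_definition scaleC_c0 :: "complex \<Rightarrow> complex c0 \<Rightarrow> complex c0" is "\<lambda>c x n. c * x n"
  using tendsto_mult_right_zero by blast


section \<open>The infinite torus\<close>

definition circle_measure :: "complex measure" where
  "circle_measure =
     distr (uniform_measure lborel {0..<2 * pi}) (restrict_space borel (sphere 0 1)) cis"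

definition torus_measure :: "(nat \<Rightarrow> complex) measure" where
  "torus_measure = (\<Pi>\<^sub>M n\<in>UNIV. circle_measure)"

lemma space_torus_measure: "space torus_measure = {w. \<forall>n. norm (w n) = 1}"
  by (auto simp: torus_measure_def circle_measure_def space_PiM space_restrict_space)

lemma prob_space_circle_measure: "prob_space circle_measure"
  unfolding circle_measure_def
proof (rule prob_space.prob_space_distr)
  show "prob_space (uniform_measure lborel {0..<2 * pi :: real})"
    by (rule prob_space_uniform_measure) auto
  have "cis \<in> borel_measurable borel"
    by (intro borel_measurable_continuous_onI continuous_intros)
  then show "cis \<in> uniform_measure lborel {0..<2 * pi} \<rightarrow>\<^sub>M restrict_space borel (sphere 0 1)"
    by (intro measurable_restrict_space2) auto
qed

lemma prob_space_torus_measure: "prob_space torus_measure"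
  unfolding torus_measure_def by (rule prob_space_PiM) (rule prob_space_circle_measure)

definition monom_fun :: "(nat \<Rightarrow>\<^sub>0 int) \<Rightarrow> (nat \<Rightarrow> complex) \<Rightarrow> complex" where
  "monom_fun \<gamma> w = (\<Prod>n\<in>Poly_Mapping.keys \<gamma>. w n powi Poly_Mapping.lookup \<gamma> n)"

definition fourier_coeff :: "((nat \<Rightarrow> complex) \<Rightarrow> complex) \<Rightarrow> (nat \<Rightarrow>\<^sub>0 int) \<Rightarrow> complex" where
  "fourier_coeff g \<gamma> = (LINT w|torus_measure. g w * cnj (monom_fun \<gamma> w))"

text \<open>Elements of \<open>L\<^sup>\<infinity>\<close> are represented by functions, not by classes of functions.\<close>

definition Linf_torus :: "((nat \<Rightarrow> complex) \<Rightarrow> complex) set" where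
  "Linf_torus =
     {g \<in> borel_measurable torus_measure. \<exists>C. AE w in torus_measure. norm (g w) \<le> C}"

definition Hinf_torus :: "((nat \<Rightarrow> complex) \<Rightarrow> complex) set" where
  "Hinf_torus =
     {g \<in> Linf_torus. \<forall>\<gamma>. (\<exists>n. Poly_Mapping.lookup \<gamma> n < 0) \<longrightarrow> fourier_coeff g \<gamma> = 0}"


section \<open>Holomorphic functions on the unit ball\<close>

text \<open>Holomorphy is Frechet differentiability over the complex numbers: the real Frechet
  derivative exists and is complex linear.\<close>

definition holomorphic_on_c0 :: "(complex c0 \<Rightarrow> complex) \<Rightarrow> complex c0 set \<Rightarrow> bool" where
  "holomorphic_on_c0 F U \<longleftrightarrow>
     (\<forall>z\<in>U. \<exists>L. (F has_derivative L) (at z) \<and> (\<forall>c h. L (scaleC_c0 c h) = c * L h))"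

text \<open>The monomial expansion on finitely supported points. Multi-indices are elements of
  \<^typ>\<open>nat \<Rightarrow>\<^sub>0 int\<close> with nonnegative entries, so that they can be shared with the Fourier
  coefficients. At a point \<open>z\<close> all monomials involving a coordinate outside the support of \<open>z\<close>
  vanish, so this is an ordinary power series in finitely many variables.\<close>

definition has_monomial_coeffs ::
    "(complex c0 \<Rightarrow> complex) \<Rightarrow> ((nat \<Rightarrow>\<^sub>0 int) \<Rightarrow> complex) \<Rightarrow> bool" where
  "has_monomial_coeffs F c \<longleftrightarrow>
     (\<forall>z\<in>ball 0 1. finite {n. coord z n \<noteq> 0} \<longrightarrow>
        ((\<lambda>\<alpha>. c \<alpha> * monom_fun \<alpha> (coord z)) has_sum F z)
          {\<alpha>. \<forall>n. 0 \<le> Poly_Mapping.lookup \<alpha> n})"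

text \<open>Values of \<open>F\<close> outside the unit ball are irrelevant.\<close>

definition is_holomorphic_extension ::
    "((nat \<Rightarrow> complex) \<Rightarrow> complex) \<Rightarrow> (complex c0 \<Rightarrow> complex) \<Rightarrow> bool" where
  "is_holomorphic_extension g F \<longleftrightarrow>
     holomorphic_on_c0 F (ball 0 1) \<and> bounded (F ` ball 0 1) \<and>
     has_monomial_coeffs F (fourier_coeff g)"


section \<open>Radii\<close>

definition radii :: "real c0 set" where
  "radii = {x. \<forall>n. coord x n \<in> {0..<1}}"

text \<open>The point with polar coordinates \<open>x\<close> and \<open>w\<close>; meaningful for \<open>w\<close> on the torus.\<close>

definition polar :: "real c0 \<Rightarrow> (nat \<Rightarrow> complex) \<Rightarrow> complex c0" where
  "polar x w = Abs_c0 (\<lambda>n. complex_of_real (coord x n) * w n)"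

lemma coord_polar:
  assumes "w \<in> space torus_measure"
  shows "coord (polar x w) n = complex_of_real (coord x n) * w n"
proof -
  have "(\<lambda>n. norm (complex_of_real (coord x n) * w n)) \<longlonglongrightarrow> 0"
    using tendsto_norm_zero[OF coord_tendsto_0[of x]] assms
    by (simp add: space_torus_measure norm_mult)
  then show ?thesis
    unfolding polar_def using tendsto_norm_zero_cancel by (subst Abs_c0_inverse) auto
qed

lemma polar_in_ball:
  assumes "x \<in> radii" "w \<in> space torus_measure"
  shows "polar x w \<in> ball 0 1"
  using assms(1) unfolding ball_c0_iff coord_polar[OF assms(2)]
  using assms(2) by (simp add: norm_mult radii_def space_torus_measure)

end

theory Submission
  imports Defs "HOL-Complex_Analysis.Complex_Analysis" "HOL-Real_Asymp.Real_Asymp"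
begin

text \<open>
  Take \<open>f = exp (- (\<Sum>n. a\<^sub>n h\<^sub>n(z\<^sub>n)))\<close>, where \<open>a\<close> is a summable sequence of positive weights and
  \<open>h\<^sub>n(z) = (1 + \<rho> z\<^sup>m) / (1 - \<rho> z\<^sup>m)\<close> has positive real part and \<open>h\<^sub>n(0) = 1\<close>; both \<open>\<rho>\<close> and \<open>m\<close>
  depend on \<open>n\<close>. The coordinates are cut into consecutive blocks, and block \<open>k\<close> contributes \<open>2\<^sup>-\<^sup>k\<close>
  times the average of the \<open>h\<^sub>n(w\<^sub>n)\<close> over the block. On the torus these averages concentrate at \<open>1\<close>,
  so by Borel-Cantelli the block series converges almost everywhere and \<open>f\<^sup>* \<noteq> 0\<close>.

  For one variable, the supremum over \<open>r\<close> of the Poisson kernel \<open>Re ((1 + r w) / (1 - r w))\<close> is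
  comparable to \<open>1 / \<bar>w - 1\<bar>\<close>, which is not integrable. So for \<open>\<rho>\<close> close to \<open>1\<close> and a suitable
  choice of radii depending on the point, the average of \<open>Re h\<^sub>n(r\<^sub>n w\<^sub>n)\<close> over a long block exceeds
  any prescribed multiple of \<open>2\<^sup>k\<close> with probability close to \<open>1\<close>. The radii have to decrease in \<open>n\<close>:
  since \<open>h\<^sub>n\<close> depends on \<open>z\<^sup>m\<close> only, the radius selected for \<open>w\<^sup>m\<close> enters through its \<open>m\<close>-th root,
  and exponents \<open>m\<close> that decrease fast enough along the block force the roots to decrease whatever was
  selected. In \<open>r\<^sup>(\<^sup>s\<^sup>)\<close> the radii of block \<open>s\<close> are selected in this way, those of the earlier blocks are a
  constant close to \<open>1\<close>, and those of the later blocks are \<open>0\<close>.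
\<close>

section \<open>Measure on the circle and the torus\<close>

lemma space_circle_measure: "space circle_measure = sphere 0 1"
  by (simp add: circle_measure_def space_restrict_space)

lemma borel_measurable_circle_measure:
  "\<phi> \<in> borel_measurable borel \<Longrightarrow> \<phi> \<in> borel_measurable circle_measure"
  unfolding circle_measure_def by (simp add: measurable_restrict_space1)

lemma borel_measurable_cnj [measurable (raw)]:
  "f \<in> borel_measurable M \<Longrightarrow> (\<lambda>x. cnj (f x)) \<in> borel_measurable M"
  by (erule measurable_compose) (intro borel_measurable_continuous_onI continuous_intros)

lemma borel_measurable_powi [measurable]:
  "(\<lambda>w :: complex. w powi i) \<in> borel_measurable borel"
  by (cases "i \<ge> 0") (auto simp: power_int_def)

lemma borel_measurable_cis [measurable]: "cis \<in> borel_measurable borel"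
  by (intro borel_measurable_continuous_onI continuous_intros)

lemma measurable_cis_circle: "cis \<in> uniform_measure lborel {0..<2 * pi} \<rightarrow>\<^sub>M restrict_space borel (sphere 0 1)"
  by (intro measurable_restrict_space2) auto

lemma emeasure_lborel_period: "emeasure lborel {0..<2 * pi} = ennreal (2 * pi)"
  by simp

lemma nn_integral_circle_measure:
  assumes [measurable]: "\<phi> \<in> borel_measurable borel"
  shows "(\<integral>\<^sup>+w. \<phi> w \<partial>circle_measure) =
    (\<integral>\<^sup>+t. \<phi> (cis t) * indicator {0..<2 * pi} t \<partial>lborel) / ennreal (2 * pi)"
proof -
  have "(\<integral>\<^sup>+w. \<phi> w \<partial>circle_measure) = (\<integral>\<^sup>+t. \<phi> (cis t) \<partial>uniform_measure lborel {0..<2 * pi})"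
    unfolding circle_measure_def
    by (rule nn_integral_distr[OF measurable_cis_circle]) (simp add: measurable_restrict_space1)
  also have "\<dots> = (\<integral>\<^sup>+t. \<phi> (cis t) * indicator {0..<2 * pi} t \<partial>lborel) / ennreal (2 * pi)"
    by (subst nn_integral_uniform_measure) (simp_all only: emeasure_lborel_period, measurable)
  finally show ?thesis .
qed

text \<open>The half-open period of the definition is replaced by the closed one, which differs from
  it by a null set: the fundamental theorem of calculus is applied on closed intervals.\<close>

lemma integral_circle_measure:
  fixes \<phi> :: "complex \<Rightarrow> 'b::euclidean_space"
  assumes [measurable]: "\<phi> \<in> borel_measurable borel"
  shows "(LINT w|circle_measure. \<phi> w) =
    (LINT t|lborel. indicator {0..2 * pi} t *\<^sub>R \<phi> (cis t)) /\<^sub>R (2 * pi)"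
proof -
  have eq: "ennreal (indicator {0..<2 * pi} t / (2 * pi)) =
      indicator {0..<2 * pi} t / ennreal (2 * pi)" for t :: real
    using divide_ennreal[of 1 "2 * pi"] by (cases "t \<in> {0..<2 * pi}") simp_all
  have "(LINT w|circle_measure. \<phi> w) =
      (LINT t|uniform_measure lborel {0..<2 * pi}. \<phi> (cis t))"
    unfolding circle_measure_def
    by (rule integral_distr[OF measurable_cis_circle]) (simp add: measurable_restrict_space1)
  also have "uniform_measure lborel {0..<2 * pi} =
      density lborel (\<lambda>t. ennreal (indicator {0..<2 * pi} t / (2 * pi)))"
    unfolding uniform_measure_def emeasure_lborel_period eq ..
  also have "(LINT t|\<dots>. \<phi> (cis t)) =
      (LINT t|lborel. (indicator {0..<2 * pi} t / (2 * pi)) *\<^sub>R \<phi> (cis t))"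
    by (rule integral_density) auto
  also have "\<dots> = (LINT t|lborel. (1 / (2 * pi)) *\<^sub>R (indicator {0..2 * pi} t *\<^sub>R \<phi> (cis t)))"
  proof (rule integral_cong_AE)
    have "t \<noteq> 2 * pi \<Longrightarrow> indicator {0..<2 * pi} t = (indicator {0..2 * pi} t :: real)" for t
      by (auto simp: indicator_def)
    then have "(indicator {0..<2 * pi} t / (2 * pi)) *\<^sub>R \<phi> (cis t) =
        (1 / (2 * pi)) *\<^sub>R (indicator {0..2 * pi} t *\<^sub>R \<phi> (cis t))" if "t \<noteq> 2 * pi" for t
      using that by simp
    then show "AE t in lborel. (indicator {0..<2 * pi} t / (2 * pi)) *\<^sub>R \<phi> (cis t) =
        (1 / (2 * pi)) *\<^sub>R (indicator {0..2 * pi} t *\<^sub>R \<phi> (cis t))"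
      by (rule eventually_mono[OF AE_lborel_singleton])
  qed measurable
  also have "\<dots> = (LINT t|lborel. indicator {0..2 * pi} t *\<^sub>R \<phi> (cis t)) /\<^sub>R (2 * pi)"
    by (simp only: integral_scaleR_right inverse_eq_divide)
  finally show ?thesis .
qed

text \<open>For k nonzero the integrand exp(i k t) has the periodic antiderivative exp(i k t) / (i
  k).\<close>

lemma integral_powi_circle_measure:
  "(LINT w|circle_measure. w powi k) = (if k = 0 then 1 else 0)"
proof (cases "k = 0")
  case True
  interpret prob_space circle_measure by (rule prob_space_circle_measure)
  show ?thesis using True by (simp add: prob_space)
next
  case False
  have "(LINT t|lborel. indicator {0..2 * pi} t *\<^sub>R cis (real_of_int k * t)) =
      cis (real_of_int k * (2 * pi)) / (\<i> * k) - cis (real_of_int k * 0) / (\<i> * k)"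
  proof (rule integral_FTC_atLeastAtMost)
    show "continuous_on {0..2 * pi} (\<lambda>t. cis (real_of_int k * t))"
      by (intro continuous_intros)
    fix x :: real
    have "((\<lambda>z. exp (\<i> * (k * z)) / (\<i> * k)) has_field_derivative exp (\<i> * (k * complex_of_real x)))
        (at (complex_of_real x))"
      using False by (auto intro!: derivative_eq_intros simp: mult.left_commute[of _ \<i>] mult.commute[of _ \<i>])
    from has_vector_derivative_real_field[OF this]
    show "((\<lambda>t. cis (real_of_int k * t) / (\<i> * complex_of_int k)) has_vector_derivative
        cis (real_of_int k * x)) (at x within {0..2 * pi})"
      by (simp add: cis_conv_exp)
  qed simp
  also have "cis (real_of_int k * (2 * pi)) = 1"
    by (simp add: cis_conv_exp exp_eq_1 algebra_simps)
  finally show ?thesis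
    using False by (simp add: integral_circle_measure cis_power_int mult.commute)
qed


section \<open>Invariance of the circle measure under power maps\<close>

lemma nn_integral_periodic_multiple:
  assumes [measurable]: "g \<in> borel_measurable borel" and per: "\<And>t. g (t + 2 * pi) = g t"
  shows "(\<integral>\<^sup>+t. g t * indicator {0..<real m * (2 * pi)} t \<partial>lborel) =
    of_nat m * (\<integral>\<^sup>+t. g t * indicator {0..<2 * pi} t \<partial>lborel)"
proof (induction m)
  case (Suc m)
  have per': "g (real m * (2 * pi) + t) = g t" for t m
  proof (induction m)
    case (Suc m)
    then show ?case using per[of "real m * (2 * pi) + t"] by (simp add: algebra_simps)
  qed simp
  have "(\<integral>\<^sup>+t. g t * indicator {0..<real (Suc m) * (2 * pi)} t \<partial>lborel) =
      (\<integral>\<^sup>+t. g t * indicator {0..<real m * (2 * pi)} t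
        + g t * indicator {real m * (2 * pi)..<real (Suc m) * (2 * pi)} t \<partial>lborel)"
  proof (rule nn_integral_cong)
    fix t
    have "c * indicator {0..<b} t = c * indicator {0..<a} t + c * indicator {a..<b} t"
      if "0 \<le> a" "a \<le> b" for a b :: real and c :: ennreal
      using that by (auto simp: indicator_def)
    from this[of "real m * (2 * pi)" "real (Suc m) * (2 * pi)"] show "g t * indicator {0..<real (Suc m) * (2 * pi)} t = g t * indicator {0..<real m * (2 * pi)} t
        + g t * indicator {real m * (2 * pi)..<real (Suc m) * (2 * pi)} t"
      by (simp del: of_nat_Suc)
  qed
  also have "\<dots> = (\<integral>\<^sup>+t. g t * indicator {0..<real m * (2 * pi)} t \<partial>lborel)
        + (\<integral>\<^sup>+t. g t * indicator {real m * (2 * pi)..<real (Suc m) * (2 * pi)} t \<partial>lborel)"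
    by (rule nn_integral_add) measurable
  also have "(\<integral>\<^sup>+t. g t * indicator {real m * (2 * pi)..<real (Suc m) * (2 * pi)} t \<partial>lborel) =
      (\<integral>\<^sup>+t. g t * indicator {0..<2 * pi} t \<partial>lborel)"
    by (subst nn_integral_real_affine[where c = 1 and t = "real m * (2 * pi)"])
      (auto simp: per' indicator_def distrib_right intro!: nn_integral_cong)
  finally show ?case unfolding Suc by (simp only: of_nat_Suc distrib_right mult_1 add.commute)
qed simp

lemma measurable_power_circle_measure: "(\<lambda>w. w ^ m) \<in> circle_measure \<rightarrow>\<^sub>M circle_measure"
  unfolding circle_measure_def
  by (simp, intro measurable_restrict_space2) (auto simp: norm_power intro!: measurable_restrict_space1)

text \<open>The substitution s = m t turns one period into m periods, each contributing the same
  amount, and the Jacobian 1 / m compensates. Hence the mean of a function of w ^ m does not depend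
  on m.\<close>

lemma distr_power_circle_measure:
  assumes "m > 0"
  shows "distr circle_measure circle_measure (\<lambda>w. w ^ m) = circle_measure"
proof -
  show ?thesis
  proof (rule measure_eqI)
    fix A assume "A \<in> sets (distr circle_measure circle_measure (\<lambda>w. w ^ m))"
    then have A: "A \<in> sets circle_measure" by simp
    then have "A \<in> sets (restrict_space borel (sphere 0 (1 :: real)))"
      by (simp add: circle_measure_def)
    then have [measurable]: "A \<in> sets borel"
      by (subst (asm) sets_restrict_space_iff) auto
    define g where "g t = (indicator A (cis t) :: ennreal)" for t
    have [measurable]: "g \<in> borel_measurable borel" unfolding g_def by measurable
    have per: "g (t + 2 * pi) = g t" for t by (simp add: g_def cis_mult[symmetric])
    have "emeasure (distr circle_measure circle_measure (\<lambda>w. w ^ m)) A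
        = (\<integral>\<^sup>+w. indicator A w \<partial>distr circle_measure circle_measure (\<lambda>w. w ^ m))"
      using A by simp
    also have "\<dots> = (\<integral>\<^sup>+w. indicator A (w ^ m) \<partial>circle_measure)"
      using A by (intro nn_integral_distr[OF measurable_power_circle_measure]) simp
    also have "\<dots> = (\<integral>\<^sup>+t. g (real m * t) * indicator {0..<2 * pi} t \<partial>lborel) / ennreal (2 * pi)"
      by (subst nn_integral_circle_measure) (simp_all add: g_def Complex.DeMoivre)
    also have "(\<integral>\<^sup>+t. g (real m * t) * indicator {0..<2 * pi} t \<partial>lborel)
        = (\<integral>\<^sup>+t. g t * indicator {0..<2 * pi} t \<partial>lborel)"
    proof -
      \<comment> \<open>The two integrals are compared after multiplication by m, which is nonzero
        and finite and so can be cancelled in \<open>ennreal\<close>.\<close>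
      have "of_nat m * (\<integral>\<^sup>+t. g t * indicator {0..<2 * pi} t \<partial>lborel)
          = (\<integral>\<^sup>+t. g t * indicator {0..<real m * (2 * pi)} t \<partial>lborel)"
        by (rule nn_integral_periodic_multiple[symmetric]) (simp_all add: per)
      also have "\<dots> = of_nat m * (\<integral>\<^sup>+t. g (real m * t) * indicator {0..<2 * pi} t \<partial>lborel)"
        using assms
        by (subst nn_integral_real_affine[where c = "real m" and t = 0])
          (auto simp: indicator_def ennreal_of_nat_eq_real_of_nat zero_le_mult_iff intro!: arg_cong2[of _ _ _ _ "(*)"] nn_integral_cong)
      finally show ?thesis
        using assms ennreal_mult_cancel_left[of "of_nat m"] by simp
    qed
    also have "\<dots> / ennreal (2 * pi) = (\<integral>\<^sup>+w. indicator A w \<partial>circle_measure)"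
      by (subst nn_integral_circle_measure) (simp_all add: g_def)
    also have "\<dots> = emeasure circle_measure A" using A by simp
    finally show "emeasure (distr circle_measure circle_measure (\<lambda>w. w ^ m)) A = emeasure circle_measure A" .
  qed simp
qed

text \<open>Since R > 1, the Taylor series at 0 converges absolutely on the circle and can be
  integrated termwise; orthogonality of the powers leaves at most one coefficient.\<close>

lemma fourier_coefficient_circle:
  assumes hol: "h holomorphic_on ball 0 R" and "R > 1"
  shows "(LINT w|circle_measure. h w * cnj (w powi k)) =
    (if k \<ge> 0 then (deriv ^^ nat k) h 0 / fact (nat k) else 0)"
proof -
  interpret prob_space circle_measure by (rule prob_space_circle_measure)
  define b where "b j = (deriv ^^ j) h 0 / fact j" for j
  have sums: "(\<lambda>j. b j * w ^ j) sums h w" if "norm w < R" for w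
    using holomorphic_power_series[OF hol, of w] that by (simp add: b_def)
  \<comment> \<open>Convergence at (1 + R) / 2, which is larger than 1, gives absolute convergence
    on the unit circle.\<close>
  have "summable (\<lambda>j. b j * of_real ((1 + R) / 2) ^ j)"
    using \<open>R > 1\<close> by (intro sums_summable[OF sums]) (simp del: of_real_divide of_real_add)
  then have sb: "summable (\<lambda>j. norm (b j))"
    using powser_insidea[of b "of_real ((1 + R) / 2)" 1] \<open>R > 1\<close> by (simp del: of_real_divide of_real_add)
  have w1: "norm w = 1" if "w \<in> space circle_measure" for w
    using that by (simp add: space_circle_measure)
  have meas: "(\<lambda>w. b j * w ^ j * cnj (w powi k)) \<in> borel_measurable circle_measure" for j
    by (intro borel_measurable_circle_measure) measurable
  have nrm: "norm (b j * w ^ j * cnj (w powi k)) = norm (b j)" if "w \<in> space circle_measure" for j w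
    using w1[OF that] by (simp add: norm_mult norm_power norm_power_int)
  have int: "integrable circle_measure (\<lambda>w. b j * w ^ j * cnj (w powi k))" for j
    by (rule integrable_const_bound[of _ "norm (b j)", OF AE_I2 meas]) (simp only: nrm order_refl)
  have "(\<lambda>j. LINT w|circle_measure. b j * w ^ j * cnj (w powi k)) sums
      (LINT w|circle_measure. suminf (\<lambda>j. b j * w ^ j * cnj (w powi k)))"
  proof (rule sums_integral[OF int])
    show "AE w in circle_measure. summable (\<lambda>j. norm (b j * w ^ j * cnj (w powi k)))"
      using sb by (intro AE_I2) (simp only: nrm)
    show "summable (\<lambda>j. LINT w|circle_measure. norm (b j * w ^ j * cnj (w powi k)))"
      using sb by (simp only: nrm cong: Bochner_Integration.integral_cong) (simp add: prob_space)
  qed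
  also have "(LINT w|circle_measure. suminf (\<lambda>j. b j * w ^ j * cnj (w powi k))) = (LINT w|circle_measure. h w * cnj (w powi k))"
    using \<open>R > 1\<close> by (intro Bochner_Integration.integral_cong refl sums_unique[symmetric] sums_mult2 sums) (auto simp: w1)
  also have "(\<lambda>j. LINT w|circle_measure. b j * w ^ j * cnj (w powi k)) = (\<lambda>j. if int j = k then b j else 0)"
  proof
    fix j
    have "(LINT w|circle_measure. b j * w ^ j * cnj (w powi k)) = (LINT w|circle_measure. b j * w powi (int j - k))"
    proof (intro Bochner_Integration.integral_cong refl)
      fix w assume "w \<in> space circle_measure"
      then have w: "norm w = 1" by (rule w1)
      then have "w \<noteq> 0" by auto
      have "cnj w = inverse w"
        using w complex_norm_square[of w] by (intro inverse_unique[symmetric]) simp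
      then show "b j * w ^ j * cnj (w powi k) = b j * w powi (int j - k)"
        using \<open>w \<noteq> 0\<close> by (simp add: power_int_diff power_int_inverse divide_inverse)
    qed
    then show "(LINT w|circle_measure. b j * w ^ j * cnj (w powi k)) = (if int j = k then b j else 0)"
      by (simp add: integral_powi_circle_measure)
  qed
  finally have *: "(\<lambda>j. if int j = k then b j else 0) sums (LINT w|circle_measure. h w * cnj (w powi k))" .
  show ?thesis
  proof (cases "k \<ge> 0")
    case True
    then have "(\<lambda>j. if int j = k then b j else 0) = (\<lambda>j. if j = nat k then b j else 0)" by (intro ext) auto
    with * True show ?thesis using sums_unique2 sums_single[of "nat k" b] by (fastforce simp: b_def)
  next
    case False
    then have "(\<lambda>j. if int j = k then b j else 0) = (\<lambda>j. 0)" by (intro ext) auto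
    with * False show ?thesis using sums_unique2[OF _ sums_zero] by fastforce
  qed
qed

section \<open>Coordinates of the torus as independent random variables\<close>

lemma measurable_torus_coord: "(\<lambda>w. w n) \<in> torus_measure \<rightarrow>\<^sub>M circle_measure"
  unfolding torus_measure_def by (rule measurable_component_singleton) simp

lemma borel_measurable_torus_coord:
  "\<phi> \<in> borel_measurable borel \<Longrightarrow> (\<lambda>w. \<phi> (w n)) \<in> borel_measurable torus_measure"
  by (rule measurable_compose[OF measurable_torus_coord]) (rule borel_measurable_circle_measure)

lemma distr_torus_coord: "distr torus_measure circle_measure (\<lambda>w. w n) = circle_measure"
  unfolding torus_measure_def
  by (rule distr_PiM_component) (auto simp: prob_space_circle_measure)

lemma integral_torus_coord:
  fixes \<phi> :: "complex \<Rightarrow> 'b::{banach, second_countable_topology}"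
  assumes "\<phi> \<in> borel_measurable borel"
  shows "(LINT w|torus_measure. \<phi> (w n)) = (LINT w|circle_measure. \<phi> w)"
proof -
  have "(LINT w|circle_measure. \<phi> w) = (LINT w|distr torus_measure circle_measure (\<lambda>w. w n). \<phi> w)"
    by (simp only: distr_torus_coord)
  also have "\<dots> = (LINT w|torus_measure. \<phi> (w n))"
    by (rule integral_distr[OF measurable_torus_coord borel_measurable_circle_measure[OF assms]])
  finally show ?thesis ..
qed

text \<open>Independence amounts to the joint law being the product of the single laws; here the
  joint law is a marginal of a product measure.\<close>

lemma indep_vars_torus_coord:
  assumes "I \<noteq> {}"
  shows "prob_space.indep_vars torus_measure (\<lambda>_. circle_measure) (\<lambda>n w. w n) I"
proof -
  interpret prob_space torus_measure by (rule prob_space_torus_measure)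
  have "distr torus_measure (\<Pi>\<^sub>M i\<in>I. circle_measure) (\<lambda>w. \<lambda>i\<in>I. w i) = (\<Pi>\<^sub>M i\<in>I. circle_measure)"
    unfolding torus_measure_def
    by (rule distr_PiM_reindex[where f = "\<lambda>i. i" and M = "\<lambda>_. circle_measure"])
      (auto simp: prob_space_circle_measure)
  then show ?thesis
    by (subst indep_vars_iff_distr_eq_PiM'[OF assms measurable_torus_coord])
      (simp add: distr_torus_coord)
qed

lemma integral_torus_prod:
  fixes \<phi> :: "nat \<Rightarrow> complex \<Rightarrow> complex"
  assumes I: "finite I"
    and meas: "\<And>n. n \<in> I \<Longrightarrow> \<phi> n \<in> borel_measurable borel"
    and bdd: "\<And>n w. n \<in> I \<Longrightarrow> norm w = 1 \<Longrightarrow> norm (\<phi> n w) \<le> C n"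
  shows "(LINT w|torus_measure. (\<Prod>n\<in>I. \<phi> n (w n))) = (\<Prod>n\<in>I. LINT w|circle_measure. \<phi> n w)"
proof (cases "I = {}")
  case True
  interpret prob_space torus_measure by (rule prob_space_torus_measure)
  show ?thesis using True by (simp add: prob_space)
next
  case False
  interpret prob_space torus_measure by (rule prob_space_torus_measure)
  have "indep_vars (\<lambda>_. borel) (\<lambda>n w. \<phi> n (w n)) I"
    by (rule indep_vars_compose2[OF indep_vars_torus_coord[OF False]])
      (rule borel_measurable_circle_measure[OF meas])
  moreover have "integrable torus_measure (\<lambda>w. \<phi> n (w n))" if "n \<in> I" for n
    using that bdd
    by (intro integrable_const_bound[of _ "C n"] AE_I2 borel_measurable_torus_coord meas)
      (auto simp: space_torus_measure)
  ultimately have "(LINT w|torus_measure. (\<Prod>n\<in>I. \<phi> n (w n))) =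
      (\<Prod>n\<in>I. LINT w|torus_measure. \<phi> n (w n))"
    by (rule indep_vars_lebesgue_integral[OF I])
  then show ?thesis
    using meas by (simp add: integral_torus_coord)
qed

text \<open>Hoeffding's inequality for independent variables with values in [-C, C]. The bound
  depends on the number of coordinates only, not on which ones they are, so it serves for blocks at
  any position.\<close>

lemma torus_deviation:
  fixes \<phi> :: "nat \<Rightarrow> complex \<Rightarrow> real" and C e \<mu> :: real
  assumes I: "finite I" "I \<noteq> {}" and "C > 0" "e \<ge> 0"
    and meas: "\<And>n. n \<in> I \<Longrightarrow> \<phi> n \<in> borel_measurable borel"
    and bdd: "\<And>n w. n \<in> I \<Longrightarrow> norm w = 1 \<Longrightarrow> \<bar>\<phi> n w\<bar> \<le> C"
    and mean: "\<And>n. n \<in> I \<Longrightarrow> (LINT w|circle_measure. \<phi> n w) = \<mu>"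
  shows "measure torus_measure {w \<in> space torus_measure. real (card I) * (\<mu> + e) \<le> (\<Sum>n\<in>I. \<phi> n (w n))}
      \<le> exp (- (real (card I) * e\<^sup>2 / (2 * C\<^sup>2)))"
    and "measure torus_measure {w \<in> space torus_measure. (\<Sum>n\<in>I. \<phi> n (w n)) \<le> real (card I) * (\<mu> - e)}
      \<le> exp (- (real (card I) * e\<^sup>2 / (2 * C\<^sup>2)))"
proof -
  interpret prob_space torus_measure by (rule prob_space_torus_measure)
  have "indep_vars (\<lambda>_. borel) (\<lambda>n w. \<phi> n (w n)) I"
    by (rule indep_vars_compose2[OF indep_vars_torus_coord[OF I(2)]])
      (rule borel_measurable_circle_measure[OF meas])
  then interpret Hoeffding_ineq torus_measure I "\<lambda>n w. \<phi> n (w n)" "\<lambda>_. - C" "\<lambda>_. C" "real (card I) * \<mu>"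
  proof unfold_locales
    show "AE w in torus_measure. \<phi> n (w n) \<in> {- C..C}" if "n \<in> I" for n
      using bdd[OF that] by (intro AE_I2) (auto simp: space_torus_measure abs_le_iff minus_le_iff)
    show "real (card I) * \<mu> \<equiv> \<Sum>n\<in>I. LINT w|torus_measure. \<phi> n (w n)"
      by (rule eq_reflection) (simp add: integral_torus_coord meas mean)
  qed (rule I)
  have pos: "card I > 0" using I by (simp add: card_gt_0_iff)
  have "2 * (real (card I) * e)\<^sup>2 / (\<Sum>n\<in>I. (C - - C)\<^sup>2) = real (card I) * e\<^sup>2 / (2 * C\<^sup>2)"
    using \<open>C > 0\<close> pos by (simp add: field_simps power2_eq_square)
  moreover have "real (card I) * e \<ge> 0" "(\<Sum>n\<in>I. (C - - C)\<^sup>2) > 0"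
    using \<open>C > 0\<close> \<open>e \<ge> 0\<close> pos by auto
  note Hoeffding_ineq_ge[OF this] Hoeffding_ineq_le[OF this]
  ultimately show "prob {w \<in> space torus_measure. real (card I) * (\<mu> + e) \<le> (\<Sum>n\<in>I. \<phi> n (w n))}
      \<le> exp (- (real (card I) * e\<^sup>2 / (2 * C\<^sup>2)))"
    "prob {w \<in> space torus_measure. (\<Sum>n\<in>I. \<phi> n (w n)) \<le> real (card I) * (\<mu> - e)}
      \<le> exp (- (real (card I) * e\<^sup>2 / (2 * C\<^sup>2)))"
    by (simp_all add: distrib_left right_diff_distrib)
qed

section \<open>Exponentials of sums of one-variable functions\<close>

lemma bounded_linear_coord: "bounded_linear (\<lambda>x :: 'a::real_normed_vector c0. coord x n)"
  by (rule bounded_linear_intro[where K = 1])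
    (simp_all add: plus_c0.rep_eq scaleR_c0.rep_eq norm_coord_le)

text \<open>The last bound follows from the others by the Schwarz lemma; it is included because it is
  immediate for the functions used here.\<close>

definition caratheodory :: "(complex \<Rightarrow> complex) \<Rightarrow> bool" where
  "caratheodory h \<longleftrightarrow> (\<exists>R>1. h holomorphic_on ball 0 R) \<and> h \<in> borel_measurable borel \<and> h 0 = 1 \<and>
     (\<forall>z. norm z \<le> 1 \<longrightarrow> Re (h z) \<ge> 0) \<and>
     (\<forall>z. norm z < 1 \<longrightarrow> norm (h z) \<le> 2 / (1 - norm z))"

text \<open>Convergence on the torus is asked only along the partial sums of length
  \<open>S k\<close>. These will be the ends of the blocks: concentration controls complete blocks
  and nothing in between.\<close>

locale torus_exponential =
  fixes a :: "nat \<Rightarrow> real" and h :: "nat \<Rightarrow> complex \<Rightarrow> complex" and S :: "nat \<Rightarrow> nat"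
  assumes a_nonneg: "a n \<ge> 0" and a_summable: "summable a"
    and h: "caratheodory (h n)"
    and S_mono: "strict_mono S"
    and conv: "AE w in torus_measure. convergent (\<lambda>k. \<Sum>n<S k. a n * h n (w n))"
begin

lemma hol: "\<exists>R>1. h n holomorphic_on ball 0 R"
  and h_meas [measurable]: "h n \<in> borel_measurable borel"
  and h_0: "h n 0 = 1"
  and Re_h: "norm z \<le> 1 \<Longrightarrow> Re (h n z) \<ge> 0"
  and h_le: "norm z < 1 \<Longrightarrow> norm (h n z) \<le> 2 / (1 - norm z)"
  using h[of n] by (auto simp: caratheodory_def)

definition F :: "complex c0 \<Rightarrow> complex" where
  "F z = exp (- suminf (\<lambda>n. a n * h n (coord z n)))"

text \<open>Where the sums diverge, \<open>lim\<close> has an unspecified value; this concerns a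
  null set only, and the exponential is nonzero in any case.\<close>

definition f :: "(nat \<Rightarrow> complex) \<Rightarrow> complex" where
  "f w = exp (- lim (\<lambda>k. \<Sum>n<S k. a n * h n (w n)))"

definition e :: "nat \<Rightarrow> complex \<Rightarrow> complex" where
  "e n z = exp (- (a n * h n z))"

definition coeff :: "nat \<Rightarrow> nat \<Rightarrow> complex" where
  "coeff n j = (deriv ^^ j) (e n) 0 / fact j"

lemma summable_norm_ah:
  assumes "q < 1" "\<And>n. norm (v n) \<le> q"
  shows "summable (\<lambda>n. norm (a n * h n (v n)))"
proof (rule summable_comparison_test')
  show "summable (\<lambda>n. a n * (2 / (1 - q)))"
    by (intro summable_mult2 a_summable)
  fix n :: nat
  have "norm (h n (v n)) \<le> 2 / (1 - norm (v n))"
    using assms(1) assms(2)[of n] by (intro h_le) simp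
  also have "\<dots> \<le> 2 / (1 - q)"
    using assms(1) assms(2)[of n] by (intro divide_left_mono) auto
  finally show "norm (norm (a n * h n (v n))) \<le> a n * (2 / (1 - q))"
    using a_nonneg[of n] mult_left_mono[of "norm (h n (v n))" "2 / (1 - q)" "a n"]
    by (simp add: norm_mult)
qed

lemma summable_ah: "z \<in> ball 0 1 \<Longrightarrow> summable (\<lambda>n. a n * h n (coord z n))"
  by (rule summable_norm_cancel, rule summable_norm_ah[of "norm z"]) (auto simp: norm_coord_le)

text \<open>Cauchy's inequality on the circle of radius (1 - q) / 2 about z, where
  \<open>h n\<close> is bounded by 4 / (1 - q). Uniformity in n is what permits termwise
  differentiation.\<close>

lemma deriv_h_le:
  assumes "q < 1" "norm z \<le> q"
  shows "norm (deriv (h n) z) \<le> 8 / (1 - q)\<^sup>2"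
proof -
  obtain R where R: "R > 1" "h n holomorphic_on ball 0 R" using hol by blast
  define r where "r = (1 - q) / 2"
  have r: "r > 0" using assms by (simp add: r_def)
  have near: "norm x \<le> (1 + q) / 2" if "norm (z - x) \<le> r" for x
    using norm_triangle_sub[of x z] that assms unfolding r_def by (simp add: norm_minus_commute field_simps)
  have sub: "cball z r \<subseteq> ball 0 R"
    using near R(1) assms(1) by (force simp: dist_norm)
  have "norm ((deriv ^^ 1) (h n) z) \<le> fact 1 * (4 / (1 - q)) / r ^ 1"
  proof (rule Cauchy_inequality[OF _ _ r])
    show "h n holomorphic_on ball z r"
      using R(2) sub ball_subset_cball by (blast intro: holomorphic_on_subset)
    show "continuous_on (cball z r) (h n)"
      using R(2) sub by (blast intro: holomorphic_on_imp_continuous_on holomorphic_on_subset)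
    fix x assume "norm (z - x) = r"
    then have x: "norm x \<le> (1 + q) / 2" using near by simp
    then have "norm (h n x) \<le> 2 / (1 - norm x)" using assms by (intro h_le) simp
    also have "\<dots> \<le> 2 / (1 - (1 + q) / 2)" using x assms by (intro divide_left_mono) auto
    also have "\<dots> = 4 / (1 - q)" using assms by (simp add: field_simps)
    finally show "norm (h n x) \<le> 4 / (1 - q)" .
  qed
  then show ?thesis by (simp add: r_def power2_eq_square)
qed

lemma h_has_derivative:
  assumes "norm z < 1"
  shows "(h n has_field_derivative deriv (h n) z) (at z)"
proof -
  obtain R where "R > 1" "h n holomorphic_on ball 0 R" using hol by blast
  then show ?thesis using assms by (intro holomorphic_derivI) auto
qed

lemma holomorphic_F: "holomorphic_on_c0 F (ball 0 1)"
  unfolding holomorphic_on_c0_def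
proof
  fix z :: "complex c0" assume "z \<in> ball 0 1"
  then have z: "norm z < 1" by simp
  \<comment> \<open>The bounds are uniform only on balls of radius less than 1, so the series is
    differentiated on an intermediate ball containing z.\<close>
  define q where "q = (1 + norm z) / 2"
  have q: "norm z < q" "q < 1" using z by (simp_all add: q_def)
  define B where "B = 8 / (1 - q)\<^sup>2"
  have B: "B > 0" using q by (simp add: B_def)
  define G where "G x v = suminf (\<lambda>n. a n * deriv (h n) (coord x n) * coord v n)"
    for x v :: "complex c0"
  have term_le: "norm (a n * deriv (h n) (coord x n) * coord v n) \<le> a n * (B * norm v)"
    if "x \<in> ball 0 q" for x v :: "complex c0" and n
  proof -
    have "norm (coord x n) \<le> q" using norm_coord_le[of x n] that by simp
    from deriv_h_le[OF q(2) this] norm_coord_le[of v n]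
    have "norm (deriv (h n) (coord x n)) * norm (coord v n) \<le> B * norm v"
      unfolding B_def[symmetric] using B by (intro mult_mono) auto
    then show ?thesis using a_nonneg[of n] by (simp add: norm_mult mult.assoc mult_left_mono)
  qed
  have sum_a: "summable (\<lambda>n. a n * c)" for c by (intro summable_mult2 a_summable)
  have G_sum: "summable (\<lambda>n. a n * deriv (h n) (coord x n) * coord v n)"
    if "x \<in> ball 0 q" for x v :: "complex c0"
    by (rule summable_comparison_test'[OF sum_a]) (rule term_le[OF that])
  \<comment> \<open>The tail of the summable weights controls the derivatives in operator norm,
    uniformly over the ball, as \<open>has_derivative_series\<close> demands.\<close>
  have tail: "norm ((\<Sum>i<n. a i * deriv (h i) (coord x i) * coord v i) - G x v)
      \<le> (suminf a - sum a {..<n}) * (B * norm v)" if x: "x \<in> ball 0 q" for x v n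
  proof -
    let ?t = "\<lambda>i. a i * deriv (h i) (coord x i) * coord v i"
    have "G x v - sum ?t {..<n} = suminf (\<lambda>i. ?t (i + n))"
      unfolding G_def using suminf_split_initial_segment[OF G_sum[OF x], of v n] by simp
    moreover have "norm (suminf (\<lambda>i. ?t (i + n))) \<le> suminf (\<lambda>i. a (i + n) * (B * norm v))"
      by (rule norm_suminf_le) (auto intro!: term_le[OF x] summable_ignore_initial_segment[OF sum_a])
    moreover have "suminf (\<lambda>i. a (i + n) * (B * norm v)) = (suminf a - sum a {..<n}) * (B * norm v)"
      using suminf_split_initial_segment[OF a_summable, of n]
        suminf_mult2[OF summable_ignore_initial_segment[OF a_summable], of n "B * norm v"]
      by simp
    ultimately show ?thesis by (metis norm_minus_commute)
  qed
  have "\<exists>g. \<forall>x\<in>ball 0 q. (\<lambda>n. a n * h n (coord x n)) sums g x \<and> (g has_derivative G x) (at x within ball 0 q)"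
  proof (rule has_derivative_series[where f' = "\<lambda>n x v. a n * deriv (h n) (coord x n) * coord v n"])
    show "convex (ball (0 :: complex c0) q)" by simp
    show "((\<lambda>x. a n * h n (coord x n)) has_derivative
        (\<lambda>v. a n * deriv (h n) (coord x n) * coord v n)) (at x within ball 0 q)"
      if "x \<in> ball 0 q" for n x
    proof -
      have "norm (coord x n) < 1" using norm_coord_le[of x n] that q by simp
      from h_has_derivative[OF this, of n]
      have "((\<lambda>x. h n (coord x n)) has_derivative (\<lambda>v. deriv (h n) (coord x n) * coord v n)) (at x)"
        unfolding has_field_derivative_def
        by (rule has_derivative_compose[OF bounded_linear_imp_has_derivative[OF bounded_linear_coord]])
      from has_derivative_mult_right[OF has_derivative_at_withinI[OF this], of "a n"]
      show ?thesis by (simp add: mult_ac)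
    qed
    show "0 \<in> ball (0 :: complex c0) q" using q by (auto intro: le_less_trans[OF norm_ge_zero])
    show "(\<lambda>n. a n * h n (coord 0 n)) sums suminf (\<lambda>n. a n * h n (coord 0 n))"
      by (intro summable_sums summable_ah) simp
    fix d :: real assume d: "d > 0"
    have "(\<lambda>n. sum a {..<n}) \<longlonglongrightarrow> suminf a" by (rule summable_LIMSEQ[OF a_summable])
    then have "(\<lambda>n. (suminf a - sum a {..<n}) * B) \<longlonglongrightarrow> (suminf a - suminf a) * B"
      by (intro tendsto_intros)
    then have "eventually (\<lambda>n. (suminf a - sum a {..<n}) * B < d) sequentially"
      using d by (intro order_tendstoD(2)) auto
    then show "\<forall>\<^sub>F n in sequentially. \<forall>x\<in>ball 0 q. \<forall>v.
        norm ((\<Sum>i<n. a i * deriv (h i) (coord x i) * coord v i) - G x v) \<le> d * norm v"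
    proof eventually_elim
      case (elim n)
      have "(suminf a - sum a {..<n}) * (B * norm v) \<le> d * norm v" for v :: "complex c0"
        using elim by (simp flip: mult.assoc) (intro mult_right_mono, auto)
      then show ?case using tail order_trans by blast
    qed
  qed
  then obtain g where g: "\<And>x. x \<in> ball 0 q \<Longrightarrow> (\<lambda>n. a n * h n (coord x n)) sums g x"
      "\<And>x. x \<in> ball 0 q \<Longrightarrow> (g has_derivative G x) (at x within ball 0 q)" by blast
  have zq: "z \<in> ball 0 q" using q by simp
  have "(g has_derivative G z) (at z)"
    using g(2)[OF zq] zq by (simp add: at_within_open[OF _ open_ball])
  then have "((\<lambda>x. - g x) has_derivative (\<lambda>v. - G z v)) (at z)" by (rule has_derivative_minus)
  from has_derivative_compose[OF this DERIV_exp[unfolded has_field_derivative_def]]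
  have "((\<lambda>x. exp (- g x)) has_derivative (\<lambda>v. exp (- g z) * - G z v)) (at z)" .
  then have "(F has_derivative (\<lambda>v. exp (- g z) * - G z v)) (at z)"
    by (rule has_derivative_transform_within_open[OF _ open_ball zq])
      (use g(1) in \<open>simp add: F_def sums_iff\<close>)
  \<comment> \<open>Each term of \<open>G z\<close> is complex linear in the direction, so the real
    derivative is complex linear.\<close>
  moreover have "exp (- g z) * - G z (scaleC_c0 c v) = c * (exp (- g z) * - G z v)" for c v
    unfolding G_def using suminf_mult[OF G_sum[OF zq], of c v]
    by (simp add: scaleC_c0.rep_eq mult_ac)
  ultimately show "\<exists>L. (F has_derivative L) (at z) \<and> (\<forall>c h. L (scaleC_c0 c h) = c * L h)"
    by blast
qed

text \<open>All terms have nonnegative real part, so dropping those outside I lowers the sum. The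
  empty set gives the bound 1 for \<open>F\<close>, a single block its decay along the
  radii.\<close>

lemma norm_F_le:
  assumes z: "z \<in> ball 0 1" and I: "finite I"
  shows "norm (F z) \<le> exp (- (\<Sum>n\<in>I. a n * Re (h n (coord z n))))"
proof -
  have "norm (coord z n) \<le> 1" for n
    using z norm_coord_le[of z n] by simp
  then have "(\<Sum>n\<in>I. a n * Re (h n (coord z n))) \<le> suminf (\<lambda>n. Re (a n * h n (coord z n)))"
    using sum_le_suminf[OF summable_Re[OF summable_ah[OF z]] I] a_nonneg Re_h by simp
  also have "\<dots> = Re (suminf (\<lambda>n. a n * h n (coord z n)))"
    by (rule Re_suminf[OF summable_ah[OF z], symmetric])
  finally show ?thesis by (simp add: F_def)
qed

lemma bounded_F: "bounded (F ` ball 0 1)"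
  using norm_F_le[of _ "{}"] by (intro boundedI[of _ 1]) auto

end

section \<open>Fourier coefficients of \<open>f\<close> and the monomial expansion of
  \<open>F\<close>\<close>

lemma has_sum_prod_PiE:
  fixes g :: "'a \<Rightarrow> 'b :: countable \<Rightarrow> complex"
  assumes "finite A" "\<And>x. x \<in> A \<Longrightarrow> (\<lambda>j. norm (g x j)) summable_on UNIV"
    and "\<And>x. x \<in> A \<Longrightarrow> (g x has_sum s x) UNIV"
  shows "((\<lambda>j. \<Prod>x\<in>A. g x (j x)) has_sum (\<Prod>x\<in>A. s x)) (PiE A (\<lambda>_. UNIV))"
proof -
  have "(\<lambda>j. norm (\<Prod>x\<in>A. g x (j x))) summable_on (PiE A (\<lambda>_. UNIV))"
    unfolding abs_summable_equivalent
    using assms by (intro abs_summable_on_prod_PiE) (auto simp flip: abs_summable_equivalent)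
  then have "(\<lambda>j. \<Prod>x\<in>A. g x (j x)) summable_on (PiE A (\<lambda>_. UNIV))"
    by (rule abs_summable_summable)
  moreover have "infsum (\<lambda>j. \<Prod>x\<in>A. g x (j x)) (PiE A (\<lambda>_. UNIV)) = (\<Prod>x\<in>A. infsum (g x) UNIV)"
    using assms by (intro infsum_prod_PiE_abs) auto
  moreover have "infsum (g x) UNIV = s x" if "x \<in> A" for x
    using assms(3)[OF that] by (rule infsumI)
  ultimately show ?thesis by (metis (no_types, lifting) has_sum_infsum prod.cong)
qed

lemma monom_fun_eq_prod:
  assumes "finite A" "Poly_Mapping.keys \<gamma> \<subseteq> A"
  shows "monom_fun \<gamma> w = (\<Prod>n\<in>A. w n powi Poly_Mapping.lookup \<gamma> n)"
  unfolding monom_fun_def using assms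
  by (intro prod.mono_neutral_left) (auto simp: in_keys_iff)

lemma norm_monom_fun:
  assumes "w \<in> space torus_measure"
  shows "norm (monom_fun \<gamma> w) = 1"
  unfolding monom_fun_def using assms
  by (simp add: prod_norm[symmetric] norm_power_int space_torus_measure)

lemma borel_measurable_monom_fun [measurable]: "monom_fun \<gamma> \<in> borel_measurable torus_measure"
  unfolding monom_fun_def
  by (intro borel_measurable_prod borel_measurable_torus_coord[of "\<lambda>w. w powi _"]) measurable

context torus_exponential
begin

lemma borel_measurable_e [measurable]: "e n \<in> borel_measurable borel"
  unfolding e_def by measurable

lemma norm_e_le: "norm z \<le> 1 \<Longrightarrow> norm (e n z) \<le> 1"
  using Re_h[of z n] a_nonneg[of n] by (simp add: e_def)

lemma e_0: "e n 0 = exp (- a n)"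
  by (simp add: e_def h_0 flip: exp_of_real of_real_minus)

lemma coeff_0: "coeff n 0 = exp (- a n)"
  by (simp add: coeff_def e_0)

lemma e_holomorphic: "\<exists>R>1. e n holomorphic_on ball 0 R"
proof -
  obtain R where "R > 1" "h n holomorphic_on ball 0 R" using hol by blast
  then show ?thesis unfolding e_def by (intro exI[of _ R] conjI holomorphic_intros)
qed

lemma e_has_sum:
  assumes "norm z < 1"
  shows "((\<lambda>j. coeff n j * z ^ j) has_sum e n z) UNIV"
    and "(\<lambda>j. norm (coeff n j * z ^ j)) summable_on UNIV"
proof -
  obtain R where R: "R > 1" "e n holomorphic_on ball 0 R" using e_holomorphic by blast
  have sums: "(\<lambda>j. coeff n j * x ^ j) sums e n x" if "norm x < R" for x
    using holomorphic_power_series[OF R(2), of x] that by (simp add: coeff_def)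
  have "summable (\<lambda>j. norm (coeff n j * z ^ j))"
    using sums[of 1] R(1) assms by (intro powser_insidea[of _ 1]) (auto intro: sums_summable)
  then show "(\<lambda>j. norm (coeff n j * z ^ j)) summable_on UNIV"
      "((\<lambda>j. coeff n j * z ^ j) has_sum e n z) UNIV"
    using sums[of z] R(1) assms
    by (auto intro: norm_summable_imp_has_sum simp: summable_on_UNIV_nonneg_real_iff)
qed

lemma e_fourier:
  "(LINT w|circle_measure. e n w * cnj (w powi k)) = (if k \<ge> 0 then coeff n (nat k) else 0)"
  using e_holomorphic fourier_coefficient_circle unfolding coeff_def by blast

definition partial :: "nat \<Rightarrow> (nat \<Rightarrow> complex) \<Rightarrow> complex" where
  "partial k w = (\<Prod>n<S k. e n (w n))"

lemma partial_eq: "partial k w = exp (- (\<Sum>n<S k. a n * h n (w n)))"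
  by (simp add: partial_def e_def exp_sum flip: sum_negf)

lemma borel_measurable_partial [measurable]: "partial k \<in> borel_measurable torus_measure"
  unfolding partial_def by (intro borel_measurable_prod borel_measurable_torus_coord) measurable

lemma norm_partial_le: "w \<in> space torus_measure \<Longrightarrow> norm (partial k w) \<le> 1"
  unfolding partial_def prod_norm[symmetric]
  by (auto simp: space_torus_measure intro!: prod_le_1 norm_e_le)

lemma borel_measurable_f [measurable]: "f \<in> borel_measurable torus_measure"
proof -
  have [measurable]: "(\<lambda>w. h n (w n)) \<in> borel_measurable torus_measure" for n
    by (rule borel_measurable_torus_coord) measurable
  show ?thesis unfolding f_def by measurable
qed

lemma partial_tendsto: "AE w in torus_measure. (\<lambda>k. partial k w) \<longlonglongrightarrow> f w"
  using conv
proof eventually_elim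
  case (elim w)
  then show ?case
    unfolding partial_eq f_def by (intro tendsto_intros) (simp add: convergent_LIMSEQ_iff)
qed

lemma f_bounded: "AE w in torus_measure. norm (f w) \<le> 1"
  using partial_tendsto AE_space
proof eventually_elim
  case (elim w)
  then show ?case
    using norm_partial_le by (intro LIMSEQ_le_const2[OF tendsto_norm[OF elim(1)]]) auto
qed

text \<open>Independence of the coordinates splits the integral into one-variable Fourier
  coefficients of the \<open>e n\<close>, which vanish at negative exponents.\<close>

lemma fourier_partial:
  assumes "Poly_Mapping.keys \<gamma> \<subseteq> {..<S k}"
  shows "(LINT w|torus_measure. partial k w * cnj (monom_fun \<gamma> w)) =
    (\<Prod>n<S k. if Poly_Mapping.lookup \<gamma> n \<ge> 0 then coeff n (nat (Poly_Mapping.lookup \<gamma> n)) else 0)"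
proof -
  have "(LINT w|torus_measure. partial k w * cnj (monom_fun \<gamma> w)) =
      (LINT w|torus_measure. (\<Prod>n<S k. e n (w n) * cnj (w n powi Poly_Mapping.lookup \<gamma> n)))"
    by (simp add: partial_def monom_fun_eq_prod[OF _ assms] prod.distrib)
  also have "\<dots> = (\<Prod>n<S k. LINT w|circle_measure. e n w * cnj (w powi Poly_Mapping.lookup \<gamma> n))"
  proof (rule integral_torus_prod[where C = "\<lambda>_. 1"])
    show "norm (e n w * cnj (w powi Poly_Mapping.lookup \<gamma> n)) \<le> 1" if "norm w = 1" for n and w :: complex
      using norm_e_le[of w n] that by (simp add: norm_mult norm_power_int)
  qed (simp, measurable)
  finally show ?thesis by (simp only: e_fourier)
qed

text \<open>Dominated convergence from the partial products. Coordinates from d on have exponent 0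
  and contribute \<open>coeff n 0\<close>, that is exp(- a n); these factors multiply to the final
  exponential. With d free, one d serves all multi-indices of a power series in d variables.\<close>

lemma fourier_f:
  assumes "Poly_Mapping.keys \<gamma> \<subseteq> {..<d}"
  shows "fourier_coeff f \<gamma> =
    (\<Prod>n<d. if Poly_Mapping.lookup \<gamma> n \<ge> 0 then coeff n (nat (Poly_Mapping.lookup \<gamma> n)) else 0)
      * exp (- of_real (suminf a - sum a {..<d}))" (is "_ = prod ?c _ * _")
proof (rule LIMSEQ_unique)
  show "(\<lambda>k. LINT w|torus_measure. partial k w * cnj (monom_fun \<gamma> w)) \<longlonglongrightarrow> fourier_coeff f \<gamma>"
    unfolding fourier_coeff_def
  proof (rule integral_dominated_convergence[where w = "\<lambda>_. 1"])
    interpret prob_space torus_measure by (rule prob_space_torus_measure)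
    show "integrable torus_measure (\<lambda>_. 1 :: real)" by simp
    show "AE w in torus_measure. (\<lambda>k. partial k w * cnj (monom_fun \<gamma> w)) \<longlonglongrightarrow> f w * cnj (monom_fun \<gamma> w)"
      using partial_tendsto by eventually_elim (intro tendsto_intros)
    show "AE w in torus_measure. norm (partial k w * cnj (monom_fun \<gamma> w)) \<le> 1" for k
      by (rule AE_I2) (simp add: norm_mult norm_monom_fun norm_partial_le)
  qed measurable
  have sub: "filterlim S at_top sequentially" by (rule filterlim_subseq[OF S_mono])
  have "(\<lambda>k. sum a {..<S k}) \<longlonglongrightarrow> suminf a"
    using filterlim_compose[OF summable_LIMSEQ[OF a_summable] sub] .
  then have "(\<lambda>k. prod ?c {..<d} * exp (- of_real (sum a {..<S k} - sum a {..<d})))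
      \<longlonglongrightarrow> prod ?c {..<d} * exp (- of_real (suminf a - sum a {..<d}))"
    by (intro tendsto_intros)
  moreover have "eventually (\<lambda>k. prod ?c {..<d} * exp (- of_real (sum a {..<S k} - sum a {..<d}))
      = (LINT w|torus_measure. partial k w * cnj (monom_fun \<gamma> w))) sequentially"
    using filterlim_at_top[THEN iffD1, OF sub, rule_format, of d]
  proof eventually_elim
    case (elim k)
    have split: "{..<S k} = {..<d} \<union> {d..<S k}" using elim by auto
    have "(LINT w|torus_measure. partial k w * cnj (monom_fun \<gamma> w)) = prod ?c {..<S k}"
      using assms elim by (intro fourier_partial) auto
    also have "\<dots> = prod ?c {..<d} * prod ?c {d..<S k}"
      unfolding split by (rule prod.union_disjoint) auto
    also have "prod ?c {d..<S k} = (\<Prod>n=d..<S k. exp (- of_real (a n)))"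
    proof (rule prod.cong)
      fix n assume "n \<in> {d..<S k}"
      then have "Poly_Mapping.lookup \<gamma> n = 0" using assms by (auto simp flip: not_in_keys_iff_lookup_eq_zero)
      then show "?c n = exp (- of_real (a n))" by (simp add: coeff_0 flip: exp_of_real of_real_minus)
    qed simp
    also have "\<dots> = exp (- of_real (sum a {..<S k} - sum a {..<d}))"
    proof -
      have "sum a {..<S k} - sum a {..<d} = sum a {d..<S k}"
        unfolding split by (subst sum.union_disjoint) auto
      then show ?thesis by (simp add: exp_sum flip: sum_negf)
    qed
    finally show ?case by simp
  qed
  ultimately show "(\<lambda>k. LINT w|torus_measure. partial k w * cnj (monom_fun \<gamma> w))
      \<longlonglongrightarrow> prod ?c {..<d} * exp (- of_real (suminf a - sum a {..<d}))"
    by (rule Lim_transform_eventually)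
qed

text \<open>A negative exponent makes one factor of the product in \<open>fourier_f\<close>
  zero.\<close>

lemma f_in_Hinf: "f \<in> Hinf_torus"
proof -
  have "fourier_coeff f \<gamma> = 0" if "Poly_Mapping.lookup \<gamma> n < 0" for \<gamma> n
  proof -
    obtain d where d: "Poly_Mapping.keys \<gamma> \<subseteq> {..<d}"
      using finite_nat_iff_bounded finite_keys by blast
    have "n \<in> Poly_Mapping.keys \<gamma>" using that by (simp add: in_keys_iff)
    with d have "n \<in> {..<d}" by blast
    then have "(\<Prod>n<d. if Poly_Mapping.lookup \<gamma> n \<ge> 0 then coeff n (nat (Poly_Mapping.lookup \<gamma> n)) else 0) = 0"
      using that by (intro prod_zero bexI[of _ n]) auto
    then show ?thesis by (simp add: fourier_f[OF d])
  qed
  then show ?thesis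
    unfolding Hinf_torus_def Linf_torus_def using f_bounded by auto
qed

text \<open>At a point supported in the first d coordinates, \<open>F z\<close> is a product of d
  one-variable Taylor series times the constant from the remaining coordinates, where every
  \<open>h n\<close> takes the value 1. The same constant occurs in
  \<open>fourier_f\<close>.\<close>

lemma monomial_coeffs_F: "has_monomial_coeffs F (fourier_coeff f)"
  unfolding has_monomial_coeffs_def
proof (intro ballI impI)
  fix z :: "complex c0" assume z: "z \<in> ball 0 1" and fin: "finite {n. coord z n \<noteq> 0}"
  obtain d where d: "{n. coord z n \<noteq> 0} \<subseteq> {..<d}" using fin finite_nat_iff_bounded by blast
  have z1: "norm (coord z n) < 1" for n using z unfolding ball_c0_iff by blast
  define E :: complex where "E = exp (- of_real (suminf a - sum a {..<d}))"
  let ?u = "\<lambda>j. (\<Prod>n<d. coeff n (j n) * coord z n ^ j n) * E"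
  let ?T = "PiE {..<d} (\<lambda>_. UNIV :: nat set)"
  let ?P = "{\<alpha>. \<forall>n. 0 \<le> Poly_Mapping.lookup \<alpha> n} :: (nat \<Rightarrow>\<^sub>0 int) set"
  let ?Q = "{\<alpha> \<in> ?P. Poly_Mapping.keys \<alpha> \<subseteq> {..<d}}"
  let ?t = "\<lambda>\<alpha>. fourier_coeff f \<alpha> * monom_fun \<alpha> (coord z)"
  have "F z = (\<Prod>n<d. e n (coord z n)) * E"
  proof -
    have zero: "coord z (n + d) = 0" for n using d by force
    have "suminf (\<lambda>n. a n * h n (coord z n)) = suminf (\<lambda>n. of_real (a (n + d))) + (\<Sum>n<d. a n * h n (coord z n))"
      using suminf_split_initial_segment[OF summable_ah[OF z], of d] by (simp add: zero h_0)
    also have "suminf (\<lambda>n. complex_of_real (a (n + d))) = of_real (suminf (\<lambda>n. a (n + d)))"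
      by (rule suminf_of_real[symmetric, OF summable_ignore_initial_segment[OF a_summable]])
    also have "suminf (\<lambda>n. a (n + d)) = suminf a - sum a {..<d}"
      by (rule suminf_minus_initial_segment[OF a_summable])
    finally have sum: "suminf (\<lambda>n. a n * h n (coord z n)) =
        of_real (suminf a - sum a {..<d}) + (\<Sum>n<d. a n * h n (coord z n))" .
    have prod: "(\<Prod>n<d. e n (coord z n)) = exp (- (\<Sum>n<d. a n * h n (coord z n)))"
      by (simp add: e_def exp_sum flip: sum_negf)
    show ?thesis
      unfolding F_def E_def sum prod by (simp add: mult_exp_exp)
  qed
  moreover have "(?u has_sum (\<Prod>n<d. e n (coord z n)) * E) ?T"
    by (intro has_sum_cmult_left has_sum_prod_PiE e_has_sum z1) simp
  \<comment> \<open>Tuples of d natural numbers correspond to multi-indices supported in the first d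
    coordinates.\<close>
  moreover have "(?u has_sum F z) ?T = (?t has_sum F z) ?Q"
  proof (rule has_sum_reindex_bij_witness[where j = "\<lambda>j. Abs_poly_mapping (\<lambda>n. if n < d then int (j n) else 0)"
        and i = "\<lambda>\<alpha>. \<lambda>n\<in>{..<d}. nat (Poly_Mapping.lookup \<alpha> n)"])
    have look: "Poly_Mapping.lookup (Abs_poly_mapping (\<lambda>n. if n < d then int (j n) else 0)) =
        (\<lambda>n. if n < d then int (j n) else 0)" for j :: "nat \<Rightarrow> nat"
      by (rule lookup_Abs_poly_mapping, rule finite_subset[of _ "{..<d}"]) auto
    fix j assume j: "j \<in> ?T"
    let ?\<alpha> = "Abs_poly_mapping (\<lambda>n. if n < d then int (j n) else 0)"
    show "(\<lambda>n\<in>{..<d}. nat (Poly_Mapping.lookup ?\<alpha> n)) = j"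
      using j by (auto simp: look fun_eq_iff PiE_def extensional_def)
    show Q: "?\<alpha> \<in> ?Q" by (auto simp: look in_keys_iff split: if_splits)
    then have "Poly_Mapping.keys ?\<alpha> \<subseteq> {..<d}" by blast
    then show "?t ?\<alpha> = ?u j"
      by (simp add: fourier_f monom_fun_eq_prod[of "{..<d}"] look E_def prod.distrib)
  next
    have look: "Poly_Mapping.lookup (Abs_poly_mapping (\<lambda>n. if n < d then int (j n) else 0)) =
        (\<lambda>n. if n < d then int (j n) else 0)" for j :: "nat \<Rightarrow> nat"
      by (rule lookup_Abs_poly_mapping, rule finite_subset[of _ "{..<d}"]) auto
    fix \<alpha> assume \<alpha>: "\<alpha> \<in> ?Q"
    show "(\<lambda>n\<in>{..<d}. nat (Poly_Mapping.lookup \<alpha> n)) \<in> ?T" by simp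
    show "Abs_poly_mapping (\<lambda>n. if n < d then int ((\<lambda>n\<in>{..<d}. nat (Poly_Mapping.lookup \<alpha> n)) n) else 0) = \<alpha>"
      using \<alpha> by (intro poly_mapping_eqI) (auto simp: look in_keys_iff)
  qed simp
  \<comment> \<open>Every other multi-index has a positive exponent at a coordinate where z
    vanishes, so its monomial is 0.\<close>
  moreover have "(?t has_sum F z) ?Q = (?t has_sum F z) ?P"
  proof (rule has_sum_cong_neutral)
    fix \<alpha> assume "\<alpha> \<in> ?P - ?Q"
    then obtain n where n: "n \<in> Poly_Mapping.keys \<alpha>" "n \<notin> {..<d}" by blast
    then have "coord z n powi Poly_Mapping.lookup \<alpha> n = 0" using d by (auto simp: in_keys_iff)
    then have "monom_fun \<alpha> (coord z) = 0"
      unfolding monom_fun_def using n(1) by (intro prod_zero) auto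
    then show "?t \<alpha> = 0" by simp
  qed auto
  ultimately show "(?t has_sum F z) ?P" by simp
qed

lemma holomorphic_extension_F: "is_holomorphic_extension f F"
  unfolding is_holomorphic_extension_def
  using holomorphic_F bounded_F monomial_coeffs_F by blast

end

section \<open>Radii with large Poisson kernels\<close>

text \<open>The Herglotz kernel: for 0 < \<rho> < 1 its real part on the unit circle is the Poisson
  kernel of radius \<rho>.\<close>

definition cayley :: "real \<Rightarrow> complex \<Rightarrow> complex" where
  "cayley \<rho> z = (1 + \<rho> * z) / (1 - \<rho> * z)"

lemma Re_cayley:
  fixes z :: complex
  assumes "norm (\<rho> * z) < 1"
  shows "Re (cayley \<rho> z) = (1 - (norm (\<rho> * z))\<^sup>2) / (norm (1 - \<rho> * z))\<^sup>2"
proof -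
  define u where "u = \<rho> * z"
  have "1 - u \<noteq> 0" using assms by (auto simp: u_def)
  have "(1 + u) / (1 - u) = (1 + u) * cnj (1 - u) / of_real ((norm (1 - u))\<^sup>2)"
    by (subst complex_div_cnj) simp
  also have "Re \<dots> = Re ((1 + u) * cnj (1 - u)) / (norm (1 - u))\<^sup>2"
    by (rule Re_divide_of_real)
  also have "Re ((1 + u) * cnj (1 - u)) = 1 - (norm u)\<^sup>2"
    unfolding cmod_power2 by (simp add: algebra_simps power2_eq_square)
  finally show ?thesis by (simp add: cayley_def u_def)
qed

lemma norm_cayley_le:
  fixes z :: complex
  assumes "norm (\<rho> * z) < 1"
  shows "norm (cayley \<rho> z) \<le> 2 / (1 - norm (\<rho> * z))"
proof -
  have "norm (1 + \<rho> * z) \<le> 2" using norm_triangle_ineq[of 1 "\<rho> * z"] assms by simp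
  moreover have "1 - norm (\<rho> * z) \<le> norm (1 - \<rho> * z)" using norm_triangle_ineq2[of 1 "\<rho> * z"] by simp
  ultimately show ?thesis
    unfolding cayley_def norm_divide using assms by (intro frac_le) auto
qed

lemma borel_measurable_cayley [measurable]: "cayley \<rho> \<in> borel_measurable borel"
  unfolding cayley_def by measurable

lemma caratheodory_cayley:
  assumes \<rho>: "0 < \<rho>" "\<rho> < 1" and m: "m > 0"
  shows "caratheodory (\<lambda>z. cayley \<rho> (z ^ m))"
proof -
  have small: "norm (\<rho> * z ^ m) \<le> \<rho>" if "norm z \<le> 1" for z :: complex
    using that \<rho> by (simp add: norm_mult norm_power mult_left_le power_le_one)
  \<comment> \<open>The poles lie on the circle of radius R, which is larger than 1.\<close>
  define R where "R = root m (1 / \<rho>)"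
  have "R > 1" using \<rho> m by (simp add: R_def)
  have "1 - \<rho> * z ^ m \<noteq> 0" if "norm z < R" for z :: complex
  proof -
    have "norm z ^ m < R ^ m" using that m by (intro power_strict_mono) auto
    also have "R ^ m = 1 / \<rho>" using \<rho> m by (simp add: R_def real_root_pow_pos2)
    finally have "norm (\<rho> * z ^ m) < 1" using \<rho> by (simp add: norm_mult norm_power field_simps)
    then show ?thesis by auto
  qed
  then have "(\<lambda>z. cayley \<rho> (z ^ m)) holomorphic_on ball 0 R"
    unfolding cayley_def by (intro holomorphic_intros) auto
  moreover have "Re (cayley \<rho> (z ^ m)) \<ge> 0" if "norm z \<le> 1" for z
  proof -
    have *: "norm (\<rho> * z ^ m) < 1" using small[OF that] \<rho>(2) by (rule le_less_trans)
    then have "(norm (\<rho> * z ^ m))\<^sup>2 \<le> 1" by (intro power_le_one) auto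
    then show ?thesis unfolding Re_cayley[OF *] by simp
  qed
  moreover have "norm (cayley \<rho> (z ^ m)) \<le> 2 / (1 - norm z)" if z: "norm z < 1" for z
  proof -
    \<comment> \<open>As m > 0 and \<rho> < 1, the argument of the kernel is at most z in modulus,
      so the bound is uniform in \<rho> and m.\<close>
    have "norm z ^ m \<le> norm z ^ 1" using z m by (intro power_decreasing) auto
    then have le: "norm (\<rho> * z ^ m) \<le> norm z"
      using \<rho> mult_mono[of \<rho> 1 "norm z ^ m" "norm z"] by (simp add: norm_mult norm_power)
    then have "norm (cayley \<rho> (z ^ m)) \<le> 2 / (1 - norm (\<rho> * z ^ m))"
      using z by (intro norm_cayley_le) auto
    also have "\<dots> \<le> 2 / (1 - norm z)"
      using le z by (intro divide_left_mono) auto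
    finally show ?thesis .
  qed
  moreover have "(\<lambda>z. cayley \<rho> (z ^ m)) \<in> borel_measurable borel" by measurable
  moreover have "cayley \<rho> (0 ^ m) = 1" by (simp add: cayley_def zero_power[OF m])
  ultimately show ?thesis
    using \<open>R > 1\<close> unfolding caratheodory_def by blast
qed

text \<open>The selected radius satisfies \<open>1 - \<rho> \<sigma>(w) \<approx> \<bar>w - 1\<bar>\<close>, where the kernel is of size \<open>1 / \<bar>w - 1\<bar>\<close>,
  cut off at \<open>\<delta>\<close>.\<close>

lemma radial_maximal_unbounded:
  fixes M :: real
  obtains \<rho> b :: real and \<sigma> :: "complex \<Rightarrow> real"
  where "0 < \<rho>" "\<rho> < 1" "1 / 2 \<le> b" "b < 1" "\<sigma> \<in> borel_measurable borel"
    "\<And>w. 1 / 2 \<le> \<sigma> w" "\<And>w. \<sigma> w \<le> b"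
    "M \<le> (LINT w|circle_measure. Re (cayley \<rho> (\<sigma> w * w)))"
proof -
  \<comment> \<open>With this choice the integral of 1 / (2 x) from \<delta> to 1 / 2, divided by 2
    pi, is (4 pi abs M + 1) / (4 pi). The summand 1 ensures \<delta> < 1 / 2 even for M = 0.\<close>
  define \<delta> where "\<delta> = exp (- (4 * pi * \<bar>M\<bar> + 1)) / 2"
  have "0 \<le> 4 * pi * \<bar>M\<bar>" by simp
  then have "- 1 < 4 * pi * \<bar>M\<bar>" by linarith
  then have "exp (- (4 * pi * \<bar>M\<bar> + 1)) < 1" by simp
  then have \<delta>: "0 < \<delta>" "\<delta> < 1 / 2" by (simp_all add: \<delta>_def)
  \<comment> \<open>Any value strictly between 1 - \<delta> and 1 gives b < 1 below.\<close>
  define \<rho> where "\<rho> = 1 - \<delta> / 2"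
  \<comment> \<open>The cap 1 / 2 keeps the selected radii at least 1 / 2; ordering the radii of
    different coordinates will rest on this lower bound.\<close>
  define t where "t w = max \<delta> (min (norm (w - 1)) (1 / 2))" for w :: complex
  define \<sigma> where "\<sigma> w = (1 - t w) / \<rho>" for w
  define b where "b = (1 - \<delta>) / \<rho>"
  have \<rho>: "0 < \<rho>" "\<rho> < 1" using \<delta> by (simp_all add: \<rho>_def)
  have b: "b < 1" using \<rho> \<delta> by (simp add: b_def \<rho>_def)
  have t: "\<delta> \<le> t w" "t w \<le> 1 / 2" for w using \<delta> by (auto simp: t_def)
  have \<sigma>: "1 / 2 \<le> \<sigma> w" "\<sigma> w \<le> b" for w
  proof -
    have "1 / 2 \<le> 1 - t w" using t[of w] by simp
    also have "\<dots> \<le> \<sigma> w" unfolding \<sigma>_def using \<rho> t[of w] by (simp add: le_divide_eq mult_left_le)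
    finally show "1 / 2 \<le> \<sigma> w" .
    show "\<sigma> w \<le> b" unfolding \<sigma>_def b_def using t[of w] \<rho> by (intro divide_right_mono) auto
  qed
  have [measurable]: "\<sigma> \<in> borel_measurable borel"
    unfolding \<sigma>_def t_def by measurable
  define \<phi> where "\<phi> w = Re (cayley \<rho> (\<sigma> w * w))" for w :: complex
  have [measurable]: "\<phi> \<in> borel_measurable borel" unfolding \<phi>_def by measurable
  have \<rho>\<sigma>: "\<rho> * (\<sigma> w * w) = (1 - t w) * w" for w :: complex using \<rho> by (simp add: \<sigma>_def)
  have nrm: "norm (\<rho> * (\<sigma> w * w)) = 1 - t w" if "norm w = 1" for w :: complex
    using t[of w] that by (simp only: \<rho>\<sigma> norm_mult norm_of_real) simp
  have eq: "\<phi> w = (1 - (1 - t w)\<^sup>2) / (norm (1 - (1 - t w) * w))\<^sup>2" if "norm w = 1" for w :: complex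
  proof -
    have "norm (\<rho> * (\<sigma> w * w)) < 1" using nrm[OF that] t[of w] \<delta> by linarith
    from Re_cayley[OF this, unfolded nrm[OF that]] show ?thesis unfolding \<phi>_def \<rho>\<sigma> by simp
  qed
  have lower: "1 / (2 * x) \<le> \<phi> (cis x)" if x: "\<delta> \<le> x" "x \<le> 1 / 2" for x
  proof -
    define T where "T = t (cis x)"
    define d where "d = norm (cis x - 1)"
    have "d = 2 * \<bar>sin (x / 2)\<bar>" unfolding d_def cis_conv_exp by (rule dist_exp_i_1)
    also have "\<dots> \<le> x" using abs_sin_x_le_abs_x[of "x / 2"] x \<delta> by simp
    finally have d: "d \<le> x" .
    then have T: "T = max \<delta> d" using x by (simp add: T_def t_def d_def)
    have T0: "0 < T" "T \<le> x" "d \<le> T" "T \<le> 1 / 2" "0 \<le> d" using T \<delta> d x by (auto simp: d_def)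
    \<comment> \<open>The squared distance is at most 2 T^2 because d \<le> T, and the numerator T
      (2 - T) is at least T, so the kernel is at least 1 / (2 T).\<close>
    have "(norm (1 - (1 - T) * cis x))\<^sup>2 = T\<^sup>2 + (1 - T) * d\<^sup>2"
    proof -
      have "(cos x)\<^sup>2 + (sin x)\<^sup>2 = 1" by simp
      then show ?thesis unfolding d_def cmod_power2 by (simp, algebra)
    qed
    also have "\<dots> \<le> T\<^sup>2 + 1 * T\<^sup>2"
      using T0 by (intro add_left_mono mult_mono power_mono) auto
    finally have den: "(norm (1 - (1 - T) * cis x))\<^sup>2 \<le> 2 * T\<^sup>2" by simp
    have "0 < 1 - norm ((1 - T) * cis x)" using T0 norm_of_real[of "1 - T", where 'a = complex] by (simp add: norm_mult)
    then have "(1 - T) * cis x \<noteq> 1" by auto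
    then have pos: "(norm (1 - (1 - T) * cis x))\<^sup>2 > 0" by simp
    have "1 / (2 * x) \<le> 1 / (2 * T)" using T0 by (intro divide_left_mono) auto
    also have "\<dots> = T / (2 * T\<^sup>2)" using T0 by (simp add: power2_eq_square)
    also have "\<dots> \<le> (1 - (1 - T)\<^sup>2) / (norm (1 - (1 - T) * cis x))\<^sup>2"
    proof (rule frac_le[OF _ _ pos den])
      have "T * 1 \<le> T * (2 - T)" using T0 by (intro mult_left_mono) auto
      then show "T \<le> 1 - (1 - T)\<^sup>2" by (simp add: power2_eq_square algebra_simps)
      then show "0 \<le> 1 - (1 - T)\<^sup>2" using T0 by simp
    qed
    also have "\<dots> = \<phi> (cis x)" using eq[of "cis x"] by (simp add: T_def)
    finally show ?thesis .
  qed
  have \<phi>_nonneg: "\<phi> w \<ge> 0" if "norm w = 1" for w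
    unfolding eq[OF that] using t[of w] \<delta> by (intro divide_nonneg_nonneg) (auto intro: power_le_one)
  have \<phi>_le: "norm (\<phi> w) \<le> 2 / \<delta>" if "norm w = 1" for w
  proof -
    have "norm (\<rho> * (\<sigma> w * w)) < 1" using nrm[OF that] t[of w] \<delta> by linarith
    from norm_cayley_le[OF this] have "norm (cayley \<rho> (\<sigma> w * w)) \<le> 2 / t w" unfolding nrm[OF that] by simp
    also have "\<dots> \<le> 2 / \<delta>" using t[of w] \<delta> by (intro divide_left_mono) auto
    finally show ?thesis unfolding \<phi>_def using abs_Re_le_cmod[of "cayley \<rho> (\<sigma> w * w)"] by simp
  qed
  have "4 * pi * \<bar>M\<bar> \<le> ln (1 / 2) - ln \<delta>" by (simp add: \<delta>_def ln_div)
  moreover have "4 * pi * M \<le> 4 * pi * \<bar>M\<bar>" by (intro mult_left_mono) auto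
  ultimately have "4 * pi * M \<le> ln (1 / 2) - ln \<delta>" by linarith
  then have "M \<le> ((ln (1 / 2) - ln \<delta>) / 2) / (2 * pi)" by (simp add: field_simps)
  also have "(ln (1 / 2) - ln \<delta>) / 2 = (LINT x|lborel. 1 / (2 * x) * indicator {\<delta>..1 / 2} x)"
  proof -
    have "(LINT x|lborel. 1 / (2 * x) * indicator {\<delta>..1 / 2} x) = ln (1 / 2) / 2 - ln \<delta> / 2"
      using \<delta> by (intro integral_FTC_Icc_real) (auto intro!: derivative_eq_intros continuous_intros)
    then show ?thesis by (simp add: diff_divide_distrib)
  qed
  also have "\<dots> \<le> (LINT x|lborel. indicator {0..2 * pi} x *\<^sub>R \<phi> (cis x))"
  proof (rule integral_mono')
    show "integrable lborel (\<lambda>x. indicator {0..2 * pi} x *\<^sub>R \<phi> (cis x))"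
      by (rule integrableI_bounded_set_indicator[where B = "2 / \<delta>"]) (auto intro!: AE_I2 \<phi>_le[simplified])
    have "1 / 2 \<le> 2 * pi" using pi_gt3 by simp
    then show "1 / (2 * x) * indicator {\<delta>..1 / 2} x \<le> indicator {0..2 * pi} x *\<^sub>R \<phi> (cis x)" for x
      using lower[of x] \<delta> \<phi>_nonneg[of "cis x"] by (auto simp: indicator_def)
    show "0 \<le> indicator {0..2 * pi} x *\<^sub>R \<phi> (cis x)" for x
      using \<phi>_nonneg[of "cis x"] by simp
  qed
  finally have "M \<le> (LINT w|circle_measure. \<phi> w)"
    by (simp add: integral_circle_measure divide_right_mono field_simps)
  moreover have "1 / 2 \<le> b" using \<sigma>[of 0] by simp
  ultimately show ?thesis
    using that[of \<rho> b \<sigma>] \<rho> b \<sigma> by (simp add: \<phi>_def)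
qed

text \<open>The order of the radii is demanded at unrelated points v and w, because the coordinates
  vary independently. The probability bound covers every offset p, because the position of a block
  depends on the lengths of the earlier ones. \<open>B\<close> lets later constant radii exceed all
  selected ones.\<close>

definition block_family ::
    "real \<Rightarrow> real \<Rightarrow> nat \<Rightarrow> (nat \<Rightarrow> complex \<Rightarrow> complex) \<Rightarrow> (nat \<Rightarrow> complex \<Rightarrow> real) \<Rightarrow> real \<Rightarrow> bool" where
  "block_family M \<epsilon> N H rad B \<longleftrightarrow> N > 0 \<and> (\<forall>j. caratheodory (H j)) \<and>
     (\<forall>j. rad j \<in> borel_measurable borel) \<and> (\<forall>j w. 0 < rad j w \<and> rad j w \<le> B) \<and> B < 1 \<and>
     (\<forall>i j v w. i < j \<longrightarrow> j < N \<longrightarrow> rad j v \<le> rad i w) \<and>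
     (\<forall>p. measure torus_measure {w \<in> space torus_measure.
        \<not> (norm (\<Sum>j<N. H j (w (p + j))) \<le> 3 * real N \<and>
           real N * M \<le> (\<Sum>j<N. Re (H j (rad j (w (p + j)) * w (p + j)))))} \<le> \<epsilon>)"

lemma integral_caratheodory:
  assumes "caratheodory h"
  shows "(LINT w|circle_measure. h w) = 1"
proof -
  obtain R where "R > 1" "h holomorphic_on ball 0 R" "h 0 = 1"
    using assms by (auto simp: caratheodory_def)
  then show ?thesis using fourier_coefficient_circle[of h R 0] by simp
qed

text \<open>The bound \<open>C\<close> and the mean of the selected kernels depend on \<rho> and
  \<sigma>, not on the exponents \<open>m j\<close>. So Hoeffding's inequality fixes the length N
  first, and the exponents, which depend on N, come afterwards.\<close>

lemma block_family_exists:
  assumes "\<epsilon> > 0"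
  shows "\<exists>N H rad B. block_family M \<epsilon> N H rad B"
proof -
  interpret prob_space torus_measure by (rule prob_space_torus_measure)
  \<comment> \<open>A mean of at least M + 1 leaves room for a deviation of 1 per
    coordinate.\<close>
  obtain \<rho> b :: real and \<sigma> :: "complex \<Rightarrow> real" where \<rho>: "0 < \<rho>" "\<rho> < 1" and b: "1 / 2 \<le> b" "b < 1"
    and \<sigma>_meas [measurable]: "\<sigma> \<in> borel_measurable borel" and \<sigma>: "\<And>w. 1 / 2 \<le> \<sigma> w" "\<And>w. \<sigma> w \<le> b"
    and mean: "M + 1 \<le> (LINT w|circle_measure. Re (cayley \<rho> (\<sigma> w * w)))"
    by (rule radial_maximal_unbounded[of "M + 1"]) (rule that)
  define \<mu> where "\<mu> = (LINT w|circle_measure. Re (cayley \<rho> (\<sigma> w * w)))"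
  define C where "C = 2 / (1 - \<rho>)"
  have C: "C > 0" using \<rho> by (simp add: C_def)
  have le_C: "norm (cayley \<rho> z) \<le> C" if "norm z \<le> 1" for z
  proof -
    have *: "norm (\<rho> * z) \<le> \<rho>" using that \<rho> by (simp add: norm_mult mult_left_le)
    then have "norm (cayley \<rho> z) \<le> 2 / (1 - norm (\<rho> * z))"
      using \<rho> by (intro norm_cayley_le) simp
    also have "\<dots> \<le> C" unfolding C_def using * \<rho> by (intro divide_left_mono) auto
    finally show ?thesis .
  qed
  \<comment> \<open>Four deviation events, each of probability at most this exponential, will be
    excluded.\<close>
  obtain N where N: "N > 0" "4 * exp (- (real N * (1 / (2 * C\<^sup>2)))) < \<epsilon>"
  proof -
    define x where "x = exp (- (1 / (2 * C\<^sup>2)))"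
    have "1 / (2 * C\<^sup>2) > 0" using C by simp
    then have x: "0 < x" "x < 1" by (simp_all add: x_def)
    obtain n where n: "x ^ n < \<epsilon> / 4" using real_arch_pow_inv[of "\<epsilon> / 4" x] assms x by auto
    have "exp (- (real (Suc n) * (1 / (2 * C\<^sup>2)))) = x ^ Suc n"
      unfolding x_def exp_of_nat_mult[symmetric] by (simp only: mult_minus_right)
    also have "\<dots> \<le> x ^ n" using x by (intro power_decreasing) auto
    finally show ?thesis using n by (intro that[of "Suc n"]) (simp_all del: of_nat_Suc)
  qed
  obtain Q where Q: "b ^ Q < 1 / 2" using real_arch_pow_inv[of "1 / 2" b] b by auto
  then have "Q > 0" by (cases Q) auto
  \<comment> \<open>\<open>Q\<close> absorbs the spread of the values of \<open>\<sigma>\<close>, which lie in \<open>{1 / 2..b}\<close>\<close>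
  define m where "m j = Q ^ (N - 1 - j)" for j
  have m: "m j > 0" "m j \<le> Q ^ N" for j
    using \<open>Q > 0\<close> by (auto simp: m_def intro!: power_increasing)
  define H where "H j z = cayley \<rho> (z ^ m j)" for j z
  \<comment> \<open>The root is undone by the power inside \<open>H j\<close>, so the kernel sees
    exactly the radius \<sigma> selects for \<open>w ^ m j\<close>.\<close>
  define rad where "rad j w = \<sigma> (w ^ m j) powr (1 / m j)" for j w
  \<comment> \<open>As b < 1, its roots grow with the degree of the root, and Q ^ N bounds all
    exponents.\<close>
  define B where "B = b powr (1 / real (Q ^ N))"
  have rad_le: "rad j w \<le> b powr (1 / m j)" for j w
    unfolding rad_def using \<sigma>[of "w ^ m j"] by (intro powr_mono2) auto
  have rad_pos: "0 < rad j w" for j w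
    using \<sigma>(1)[of "w ^ m j"] by (simp add: rad_def)
  have "b powr (1 / m j) \<le> B" for j
    unfolding B_def using b m[of j] \<open>Q > 0\<close>
    by (intro powr_mono') (auto intro!: divide_left_mono simp flip: of_nat_power)
  then have rad_B: "rad j w \<le> B" for j w using rad_le order_trans by blast
  have "B < 1" using powr_less_mono2[of "1 / real (Q ^ N)" b 1] b \<open>Q > 0\<close> by (simp add: B_def)
  \<comment> \<open>The worst case sets the largest value b at j against the smallest value 1 / 2 at
    i. After raising to the power \<open>m i\<close> it reads b ^ (Q ^ k) \<le> 1 / 2 with k > 0.
    The condition j < N keeps the truncated subtraction in \<open>m\<close> exact.\<close>
  have dec: "rad j v \<le> rad i w" if "i < j" "j < N" for i j v w
  proof -
    define k where "k = j - i"
    have mi: "m i = Q ^ k * m j" "k > 0" using that by (auto simp: m_def k_def simp flip: power_add)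
    have Q1: "Q \<le> Q ^ k" using \<open>Q > 0\<close> \<open>k > 0\<close> power_increasing[of 1 k Q] by simp
    have "rad j v \<le> b powr (1 / m j)" by (rule rad_le)
    also have "1 / real (m j) = real (Q ^ k) * (1 / m i)" using m[of i] \<open>Q > 0\<close> by (simp add: mi)
    also have "b powr \<dots> = (b ^ (Q ^ k)) powr (1 / m i)"
      using b by (simp add: powr_powr flip: powr_realpow)
    also have "\<dots> \<le> (1 / 2) powr (1 / m i)"
    proof (rule powr_mono2)
      have "b ^ (Q ^ k) \<le> b ^ Q" using b Q1 by (intro power_decreasing) auto
      then show "b ^ (Q ^ k) \<le> 1 / 2" using Q by simp
    qed (use b in auto)
    also have "\<dots> \<le> rad i w" unfolding rad_def using \<sigma>[of "w ^ m i"] by (intro powr_mono2) auto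
    finally show ?thesis .
  qed
  have [measurable]: "rad j \<in> borel_measurable borel" for j unfolding rad_def by measurable
  have car: "caratheodory (H j)" for j unfolding H_def by (rule caratheodory_cayley[OF \<rho> m(1)])
  have [measurable]: "H j \<in> borel_measurable borel" for j unfolding H_def by measurable
  have H_le: "norm (H j w) \<le> C" if "norm w \<le> 1" for j w
    unfolding H_def using that by (intro le_C) (simp add: norm_power power_le_one)
  have H_int: "integrable circle_measure (H j)" for j
  proof -
    interpret circle: prob_space circle_measure by (rule prob_space_circle_measure)
    show ?thesis
      by (rule circle.integrable_const_bound[of _ C])
        (auto intro!: AE_I2 H_le borel_measurable_circle_measure simp: space_circle_measure)
  qed
  have mean_Re: "(LINT w|circle_measure. Re (H j w)) = 1" for j
    using integral_bounded_linear[OF bounded_linear_Re H_int, of j] integral_caratheodory[OF car, of j] by simp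
  have mean_Im: "(LINT w|circle_measure. Im (H j w)) = 0" for j
    using integral_bounded_linear[OF bounded_linear_Im H_int, of j] integral_caratheodory[OF car, of j] by simp
  define X where "X j w = Re (H j (rad j w * w))" for j and w :: complex
  have X_eq: "X j w = Re (cayley \<rho> (\<sigma> (w ^ m j) * w ^ m j))" for j and w :: complex
  proof -
    have "rad j w ^ m j = \<sigma> (w ^ m j)"
      using m[of j] \<sigma>(1)[of "w ^ m j"]
      by (simp add: rad_def powr_powr flip: powr_realpow)
    then show ?thesis by (simp add: X_def H_def power_mult_distrib flip: of_real_power)
  qed
  \<comment> \<open>The power map preserves the circle measure, so the mean is the same for every
    exponent.\<close>
  have mean_X: "(LINT w|circle_measure. X j w) = \<mu>" for j
  proof -
    have "(LINT w|distr circle_measure circle_measure (\<lambda>w. w ^ m j). Re (cayley \<rho> (\<sigma> w * w)))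
        = (LINT w|circle_measure. Re (cayley \<rho> (\<sigma> (w ^ m j) * w ^ m j)))"
      by (rule integral_distr[OF measurable_power_circle_measure]) (intro borel_measurable_circle_measure, measurable)
    also have "\<dots> = (LINT w|circle_measure. X j w)"
      by (intro Bochner_Integration.integral_cong refl) (simp only: X_eq)
    finally show ?thesis by (simp add: distr_power_circle_measure[OF m(1)] \<mu>_def)
  qed
  have X_le: "\<bar>X j w\<bar> \<le> C" if "norm w = 1" for j and w :: complex
  proof -
    have "norm (rad j w * w) \<le> 1" using that rad_pos[of j w] rad_B[of j w] \<open>B < 1\<close> by (simp add: norm_mult)
    then show ?thesis unfolding X_def using H_le abs_Re_le_cmod order_trans by blast
  qed
  have [measurable]: "X j \<in> borel_measurable borel" for j unfolding X_def by measurable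
  have "prob {w \<in> space torus_measure. \<not> (norm (\<Sum>j<N. H j (w (p + j))) \<le> 3 * real N \<and>
      real N * M \<le> (\<Sum>j<N. Re (H j (rad j (w (p + j)) * w (p + j)))))} \<le> \<epsilon>" (is "prob ?bad \<le> _") for p
  proof -
    let ?I = "{p..<p + N}"
    have I: "finite ?I" "?I \<noteq> {}" using N by auto
    have shift: "(\<Sum>n\<in>?I. g (n - p) (w n)) = (\<Sum>j<N. g j (w (p + j)))"
      for g :: "nat \<Rightarrow> complex \<Rightarrow> real" and w
      by (rule sum.reindex_bij_witness[of _ "\<lambda>j. p + j" "\<lambda>n. n - p"]) auto
    have dev: "prob {w \<in> space torus_measure. N * (\<nu> + 1) \<le> (\<Sum>j<N. g j (w (p + j)))} \<le> exp (- (N * (1 / (2 * C\<^sup>2))))"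
        "prob {w \<in> space torus_measure. (\<Sum>j<N. g j (w (p + j))) \<le> N * (\<nu> - 1)} \<le> exp (- (N * (1 / (2 * C\<^sup>2))))"
      if "\<And>j. g j \<in> borel_measurable borel" "\<And>j w. norm w = 1 \<Longrightarrow> \<bar>g j w\<bar> \<le> C"
        "\<And>j. (LINT w|circle_measure. g j w) = \<nu>" for g :: "nat \<Rightarrow> complex \<Rightarrow> real" and \<nu> :: real
      using torus_deviation[OF I C zero_le_one, of "\<lambda>n. g (n - p)" \<nu>] that by (simp_all add: shift)
    \<comment> \<open>Outside these events the real part of the block sum, which is nonnegative, is
      below 2 N and the imaginary part below N in modulus, whence the constant 3. \<open>A4\<close>
      guards the sum at the selected radii.\<close>
    define A1 where "A1 = {w \<in> space torus_measure. real N * (1 + 1) \<le> (\<Sum>j<N. Re (H j (w (p + j))))}"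
    define A2 where "A2 = {w \<in> space torus_measure. real N * (0 + 1) \<le> (\<Sum>j<N. Im (H j (w (p + j))))}"
    define A3 where "A3 = {w \<in> space torus_measure. (\<Sum>j<N. Im (H j (w (p + j)))) \<le> real N * (0 - 1)}"
    define A4 where "A4 = {w \<in> space torus_measure. (\<Sum>j<N. X j (w (p + j))) \<le> real N * (\<mu> - 1)}"
    note defs = A1_def A2_def A3_def A4_def
    have [measurable]: "(\<lambda>w. Re (H j (w n))) \<in> borel_measurable torus_measure"
      "(\<lambda>w. Im (H j (w n))) \<in> borel_measurable torus_measure"
      "(\<lambda>w. X j (w n)) \<in> borel_measurable torus_measure" for j n
      by (rule borel_measurable_torus_coord, measurable)+
    have sets [measurable]: "A1 \<in> events" "A2 \<in> events" "A3 \<in> events" "A4 \<in> events"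
      unfolding defs by measurable
    have abs: "\<bar>Re (H j w)\<bar> \<le> C" "\<bar>Im (H j w)\<bar> \<le> C" if "norm w = 1" for j w
      using that H_le[of w j] abs_Re_le_cmod[of "H j w"] abs_Im_le_cmod[of "H j w"] by simp_all
    have P: "prob A1 \<le> exp (- (N * (1 / (2 * C\<^sup>2))))" "prob A2 \<le> exp (- (N * (1 / (2 * C\<^sup>2))))"
      "prob A3 \<le> exp (- (N * (1 / (2 * C\<^sup>2))))" "prob A4 \<le> exp (- (N * (1 / (2 * C\<^sup>2))))"
      unfolding defs
      by ((rule dev(1) dev(2), measurable, simp add: abs X_le, simp add: mean_Re mean_Im mean_X)+)
    have "?bad \<subseteq> A1 \<union> A2 \<union> A3 \<union> A4"
    proof
      fix w
      assume w: "w \<in> ?bad"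
      show "w \<in> A1 \<union> A2 \<union> A3 \<union> A4"
      proof (rule ccontr)
        assume "w \<notin> A1 \<union> A2 \<union> A3 \<union> A4"
        then have *: "(\<Sum>j<N. Re (H j (w (p + j)))) < 2 * N" "\<bar>\<Sum>j<N. Im (H j (w (p + j)))\<bar> < N"
          "real N * (\<mu> - 1) < (\<Sum>j<N. X j (w (p + j)))"
          using w by (auto simp: defs)
        have "norm (w n) = 1" for n using w by (simp add: space_torus_measure)
        then have "0 \<le> (\<Sum>j<N. Re (H j (w (p + j))))"
          using car by (intro sum_nonneg) (simp add: caratheodory_def)
        then have "norm (\<Sum>j<N. H j (w (p + j))) \<le> 3 * real N"
          using *(1,2) cmod_le[of "\<Sum>j<N. H j (w (p + j))"] by simp
        moreover have "real N * M \<le> real N * (\<mu> - 1)" using mean by (intro mult_left_mono) (auto simp: \<mu>_def)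
        then have "real N * M \<le> (\<Sum>j<N. Re (H j (rad j (w (p + j)) * w (p + j))))"
          using *(3) by (simp add: X_def)
        ultimately show False using w by simp
      qed
    qed
    then have "prob ?bad \<le> prob (A1 \<union> A2 \<union> A3 \<union> A4)"
      by (rule finite_measure_mono) measurable
    also have "\<dots> \<le> prob A1 + prob A2 + prob A3 + prob A4"
      using measure_Un_le[of "A1 \<union> A2 \<union> A3" torus_measure A4] measure_Un_le[of "A1 \<union> A2" torus_measure A3]
        measure_Un_le[of A1 torus_measure A2] sets by simp
    also have "\<dots> \<le> 4 * exp (- (N * (1 / (2 * C\<^sup>2))))" using P by simp
    finally show ?thesis using N(2) by simp
  qed
  then have "block_family M \<epsilon> N H rad B"
    unfolding block_family_def using N car rad_pos rad_B \<open>B < 1\<close> dec by auto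
  then show ?thesis by blast
qed

section \<open>Assembling the blocks\<close>

definition unit_c0 :: "nat \<Rightarrow> real c0" where
  "unit_c0 n = Abs_c0 (\<lambda>i. if i = n then 1 else 0)"

lemma coord_unit_c0: "coord (unit_c0 n) i = (if i = n then 1 else 0)"
proof -
  have "(\<lambda>i. if i = n then 1 else 0 :: real) \<longlonglongrightarrow> 0"
    by (rule tendsto_eventually, rule eventually_sequentiallyI[of "Suc n"]) auto
  then show ?thesis by (simp add: unit_c0_def Abs_c0_inverse)
qed

text \<open>As a finite combination of unit vectors it is continuous in v for the product topology,
  which yields Borel measurability into \<open>c0\<close>.\<close>

definition truncate_c0 :: "nat \<Rightarrow> (nat \<Rightarrow> real) \<Rightarrow> real c0" where
  "truncate_c0 d v = (\<Sum>n<d. v n *\<^sub>R unit_c0 n)"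

lemma coord_truncate_c0: "coord (truncate_c0 d v) i = (if i < d then v i else 0)"
proof -
  have "coord (truncate_c0 d v) i = (\<Sum>n<d. coord (v n *\<^sub>R unit_c0 n) i)"
    unfolding truncate_c0_def
    by (rule linear_sum[OF bounded_linear.linear[OF bounded_linear_coord]])
  also have "\<dots> = (\<Sum>n<d. if n = i then v n else 0)"
    by (rule sum.cong) (auto simp: scaleR_c0.rep_eq coord_unit_c0)
  also have "\<dots> = (if i < d then v i else 0)" by simp
  finally show ?thesis .
qed

lemma measurable_truncate_c0:
  assumes "\<And>n. (\<lambda>w. v w n) \<in> borel_measurable M"
  shows "(\<lambda>w. truncate_c0 d (v w)) \<in> borel_measurable M"
proof (rule measurable_compose[of v])
  show "v \<in> borel_measurable M"
    by (rule measurable_coordinatewise_then_product) (rule assms)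
  have "continuous_on UNIV (\<lambda>v :: nat \<Rightarrow> real. v n)" for n
    by (rule continuous_on_product_coordinates)
  then show "truncate_c0 d \<in> borel_measurable borel"
    unfolding truncate_c0_def
    by (intro borel_measurable_continuous_onI continuous_intros)
qed

lemma sum_atLeastLessThan_shift:
  fixes g :: "nat \<Rightarrow> 'a::comm_monoid_add"
  shows "(\<Sum>n\<in>{p..<p + N}. g n) = (\<Sum>j<N. g (p + j))"
  by (rule sum.reindex_bij_witness[of _ "\<lambda>j. p + j" "\<lambda>n. n - p"]) auto

lemma sum_consecutive_blocks:
  fixes g :: "nat \<Rightarrow> 'a::comm_monoid_add" and N :: "nat \<Rightarrow> nat"
  shows "(\<Sum>n<sum N {..<k}. g n) = (\<Sum>i<k. \<Sum>j<N i. g (sum N {..<i} + j))"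
proof (induction k)
  case (Suc k)
  have "{..<sum N {..<Suc k}} = {..<sum N {..<k}} \<union> {sum N {..<k}..<sum N {..<k} + N k}"
    by auto
  then have "(\<Sum>n<sum N {..<Suc k}. g n) =
      (\<Sum>n<sum N {..<k}. g n) + (\<Sum>n\<in>{sum N {..<k}..<sum N {..<k} + N k}. g n)"
    by (metis (no_types) finite_lessThan finite_atLeastLessThan sum.union_disjoint ivl_disj_int_one(2))
  then show ?case by (simp add: Suc sum_atLeastLessThan_shift)
qed simp

theorem theorem2p1:
  "\<exists>(f :: (nat \<Rightarrow> complex) \<Rightarrow> complex) (F :: complex c0 \<Rightarrow> complex)
     (r :: nat \<Rightarrow> (nat \<Rightarrow> complex) \<Rightarrow> real c0).
     f \<in> Hinf_torus \<and> is_holomorphic_extension f F \<and>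
     (AE w in torus_measure. f w \<noteq> 0) \<and>
     (\<forall>s. r s \<in> torus_measure \<rightarrow>\<^sub>M restrict_space borel radii) \<and>
     (AE w in torus_measure.
        (\<forall>s. decseq (coord (r s w))) \<and>
        (\<forall>n s. coord (r s w) n \<le> coord (r (Suc s) w) n) \<and>
        (\<forall>n. (\<lambda>s. coord (r s w) n) \<longlonglongrightarrow> 1) \<and>
        (\<lambda>s. F (polar (r s w) w)) \<longlonglongrightarrow> 0)"
proof -
  interpret prob_space torus_measure by (rule prob_space_torus_measure)
  \<comment> \<open>With weight 2 ^ -k, a block average of at least 2 ^ k * k contributes at least k
    to the exponent. The failure probabilities 2 ^ -k are summable, as Borel-Cantelli
    requires.\<close>
  have "\<forall>k. \<exists>N H rad B. block_family (2 ^ k * real k) ((1 / 2) ^ k) N H rad B"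
    by (intro allI block_family_exists) simp
  then obtain N H rad B where fam: "\<And>k. block_family (2 ^ k * real k) ((1 / 2) ^ k) (N k) (H k) (rad k) (B k)"
    by metis
  note fam' = fam[unfolded block_family_def]
  have N: "N k > 0" and car: "caratheodory (H k j)" and rad_meas: "rad k j \<in> borel_measurable borel"
    and rad: "0 < rad k j w" "rad k j w \<le> B k" and B: "B k < 1" for k j w
    using fam'[of k] by simp_all
  have rad_dec: "rad k j v \<le> rad k i w" if "i < j" "j < N k" for k i j v w
    using fam'[of k] that by simp
  have dev: "prob {w \<in> space torus_measure.
        \<not> (norm (\<Sum>j<N k. H k j (w (p + j))) \<le> 3 * real (N k) \<and>
           real (N k) * (2 ^ k * real k) \<le> (\<Sum>j<N k. Re (H k j (rad k j (w (p + j)) * w (p + j)))))} \<le> (1 / 2) ^ k"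
    for k p
    using fam'[of k] by (elim conjE) (erule spec)
  define S where "S k = sum N {..<k}" for k
  have S_Suc: "S (Suc k) = S k + N k" for k by (simp add: S_def)
  have S_mono: "strict_mono S" by (rule strict_mono_Suc_iff[THEN iffD2]) (simp add: S_Suc N)
  \<comment> \<open>The block containing the coordinate n; n - S (K n) is then the position of n in
    it.\<close>
  define K where "K n = (LEAST k. n < S (Suc k))" for n
  have S_ge: "n \<le> S n" for n using S_mono by (rule strict_mono_imp_increasing)
  have K_less: "n < S (Suc (K n))" for n
  proof -
    have "n < S (Suc n)" using S_ge[of "Suc n"] by simp
    then show ?thesis unfolding K_def by (rule LeastI)
  qed
  have K_ge: "S (K n) \<le> n" for n
  proof (cases "K n")
    case (Suc k)
    then have "\<not> n < S (Suc k)" using not_less_Least[of k "\<lambda>k. n < S (Suc k)"] by (simp add: K_def)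
    then show ?thesis using Suc by simp
  qed (simp add: S_def)
  have K_eq: "K n = k" if "S k \<le> n" "n < S (Suc k)" for n k
    using that K_ge[of n] K_less[of n] strict_mono_less[OF S_mono, of k "Suc (K n)"]
      strict_mono_less[OF S_mono, of "K n" "Suc k"] by auto
  have K_mono: "K n \<le> K m" if "n \<le> m" for n m
    using that K_ge[of n] K_less[of m] strict_mono_less[OF S_mono, of "K n" "Suc (K m)"] by auto
  have block_sum: "(\<Sum>n\<in>{S k..<S (Suc k)}. g n) = (\<Sum>j<N k. g (S k + j))" for g :: "nat \<Rightarrow> real" and k
    unfolding S_Suc by (rule sum_atLeastLessThan_shift)
  note blocks = sum_consecutive_blocks[of _ N, folded S_def]
  define a where "a n = (1 / 2) ^ K n / real (N (K n))" for n
  define h where "h n = H (K n) (n - S (K n))" for n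
  define \<rho> where "\<rho> n = rad (K n) (n - S (K n))" for n
  have K_S: "K (S k + j) = k" if "j < N k" for k j
    using that by (intro K_eq) (simp_all add: S_Suc)
  have a_S: "a (S k + j) = (1 / 2) ^ k / real (N k)" and h_S: "h (S k + j) = H k j"
    and \<rho>_S: "\<rho> (S k + j) = rad k j" if "j < N k" for k j
    using K_S[OF that] by (simp_all add: a_def h_def \<rho>_def)
  have a_nonneg: "a n \<ge> 0" for n by (simp add: a_def)
  have "summable a"
  proof (rule summableI_nonneg_bounded[OF a_nonneg])
    fix n
    have "sum a {..<n} \<le> sum a {..<S n}"
      using S_ge[of n] a_nonneg by (intro sum_mono2) auto
    also have "\<dots> = (\<Sum>i<n. \<Sum>j<N i. (1 / 2) ^ i / real (N i))"
      unfolding blocks by (intro sum.cong refl) (simp add: a_S)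
    also have "\<dots> = (\<Sum>i<n. (1 / 2) ^ i)" using N by simp
    also have "\<dots> \<le> suminf (\<lambda>i. (1 / 2) ^ i)" by (intro sum_le_suminf) auto
    finally show "sum a {..<n} \<le> suminf (\<lambda>i. (1 / 2) ^ i)" .
  qed
  define good where "good k w \<longleftrightarrow> norm (\<Sum>j<N k. H k j (w (S k + j))) \<le> 3 * real (N k) \<and>
      real (N k) * (2 ^ k * real k) \<le> (\<Sum>j<N k. Re (H k j (rad k j (w (S k + j)) * w (S k + j))))"
    for k and w :: "nat \<Rightarrow> complex"
  define bad where "bad k = {w \<in> space torus_measure. \<not> good k w}" for k
  have [measurable]: "H k j \<in> borel_measurable borel" for k j using car by (simp add: caratheodory_def)
  note rad_meas [measurable]
  have [measurable]: "(\<lambda>w. H k j (w n)) \<in> borel_measurable torus_measure"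
    "(\<lambda>w. Re (H k j (rad k j (w n) * w n))) \<in> borel_measurable torus_measure" for k j n
    by (rule borel_measurable_torus_coord, measurable)+
  have bad_sets: "bad k \<in> events" for k unfolding bad_def good_def by measurable
  have bad_le: "prob (bad k) \<le> (1 / 2) ^ k" for k unfolding bad_def good_def by (rule dev)
  have "AE w in torus_measure. eventually (\<lambda>k. w \<in> space torus_measure - bad k) sequentially"
  proof (rule borel_cantelli_AE1[OF bad_sets])
    show "summable (\<lambda>k. prob (bad k))"
      by (rule summable_comparison_test'[OF summable_geometric[of "1 / 2 :: real"]]) (simp_all add: bad_le)
  qed (simp add: emeasure_eq_measure)
  then have good: "AE w in torus_measure. w \<in> space torus_measure \<and> eventually (\<lambda>k. good k w) sequentially"
    using AE_space
  proof eventually_elim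
    case (elim w)
    from elim(1) have "eventually (\<lambda>k. good k w) sequentially"
      by (rule eventually_mono) (simp add: bad_def)
    with elim(2) show ?case ..
  qed
  interpret torus_exponential a h S
  proof
    show "caratheodory (h n)" for n unfolding h_def by (rule car)
    show "AE w in torus_measure. convergent (\<lambda>k. \<Sum>n<S k. a n * h n (w n))"
      using good
    proof eventually_elim
      case (elim w)
      have "(\<Sum>n<S k. a n * h n (w n)) = (\<Sum>i<k. (1 / 2) ^ i / N i * (\<Sum>j<N i. H i j (w (S i + j))))" for k
        unfolding blocks sum_distrib_left by (intro sum.cong refl) (simp add: a_S h_S)
      \<comment> \<open>In a good block the average has norm at most 3, so almost every point has a
        geometric majorant from some block on.\<close>
      moreover have "summable (\<lambda>i. (1 / 2) ^ i / N i * (\<Sum>j<N i. H i j (w (S i + j))))"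
      proof (rule summable_comparison_test_ev)
        show "summable (\<lambda>i. 3 * (1 / 2 :: real) ^ i)" by (intro summable_mult summable_geometric) simp
        from elim have "eventually (\<lambda>i. good i w) sequentially" ..
        then show "\<forall>\<^sub>F i in sequentially. norm ((1 / 2) ^ i / N i * (\<Sum>j<N i. H i j (w (S i + j)))) \<le> 3 * (1 / 2) ^ i"
        proof eventually_elim
          case (elim i)
          then have "norm (\<Sum>j<N i. H i j (w (S i + j))) \<le> 3 * real (N i)" by (simp add: good_def)
          then have "(1 / 2) ^ i / real (N i) * norm (\<Sum>j<N i. H i j (w (S i + j))) \<le> (1 / 2) ^ i / real (N i) * (3 * real (N i))"
            by (rule mult_left_mono) simp
          also have "\<dots> = 3 * (1 / 2) ^ i" using N[of i] by simp
          finally show ?case by (simp add: norm_mult norm_divide norm_power)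
        qed
      qed
      ultimately show ?case by (simp add: summable_iff_convergent)
    qed
  qed fact+
  \<comment> \<open>\<open>B\<close> makes the constant radius dominate the selected ones, 1 - 1 /
    (k + 2) drives it to 1, and the maximum over k \<le> s makes it monotone in s.\<close>
  define R where "R s = Max ((\<lambda>k. max (B k) (1 - 1 / real (k + 2))) ` {..s})" for s
  have R_ge: "B s \<le> R s" "1 - 1 / real (s + 2) \<le> R s" for s
  proof -
    have "max (B s) (1 - 1 / real (s + 2)) \<le> R s" unfolding R_def by (intro Max_ge) auto
    then show "B s \<le> R s" "1 - 1 / real (s + 2) \<le> R s" by simp_all
  qed
  have R_less: "R s < 1" for s unfolding R_def using B by (subst Max_less_iff) auto
  have R_mono: "R s \<le> R (Suc s)" for s unfolding R_def by (intro Max_mono) auto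
  have R_nonneg: "0 \<le> R s" for s using R_ge(2)[of s] by (rule order_trans[rotated]) simp
  have R_lim: "R \<longlonglongrightarrow> 1"
  proof (rule tendsto_sandwich[where h = "\<lambda>_. 1"])
    show "(\<lambda>s. 1 - 1 / real (s + 2)) \<longlonglongrightarrow> 1"
      by real_asymp
  qed (use R_ge(2) R_less in \<open>auto intro: always_eventually less_imp_le\<close>)
  define v where "v s w n = (if K n < s then R s else if K n = s then \<rho> n (w n) else 0)"
    for s and w :: "nat \<Rightarrow> complex" and n
  \<comment> \<open>S (Suc s) is the end of block s, from where on \<open>v s w\<close> is 0 anyway;
    truncation only turns it into an element of \<open>c0\<close>.\<close>
  define r where "r s w = truncate_c0 (S (Suc s)) (v s w)" for s w
  have \<rho>_bounds: "0 < \<rho> n w" "\<rho> n w \<le> B (K n)" for n w unfolding \<rho>_def by (rule rad)+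
  have coord_r: "coord (r s w) n = v s w n" for s w n
  proof (cases "n < S (Suc s)")
    case False
    then have "S (Suc s) < S (Suc (K n))" using K_less[of n] by linarith
    then have "s < K n" using strict_mono_less[OF S_mono, of "Suc s" "Suc (K n)"] by simp
    then show ?thesis using False by (simp add: r_def coord_truncate_c0 v_def)
  qed (simp add: r_def coord_truncate_c0)
  have v_range: "0 \<le> v s w n" "v s w n < 1" for s w n
    using R_nonneg[of s] R_less[of s] \<rho>_bounds[of n "w n"] B[of s] by (auto simp: v_def less_imp_le)
  have r_radii: "r s w \<in> radii" for s w by (simp add: radii_def coord_r v_range)
  have r_meas: "r s \<in> torus_measure \<rightarrow>\<^sub>M restrict_space borel radii" for s
  proof (rule measurable_restrict_space2)
    have [measurable]: "(\<lambda>w. \<rho> n (w n)) \<in> borel_measurable torus_measure" for n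
      unfolding \<rho>_def by (rule borel_measurable_torus_coord) (rule rad_meas)
    show "r s \<in> borel_measurable torus_measure"
      unfolding r_def v_def by (intro measurable_truncate_c0) measurable
  qed (use r_radii in auto)
  \<comment> \<open>Along n the values are \<open>R s\<close>, then the selected radii of block s,
    then 0. The first jump goes down since selected radii are at most B s \<le> R s; inside the
    block \<open>rad_dec\<close> applies.\<close>
  have r_dec: "decseq (coord (r s w))" for s w
    unfolding decseq_Suc_iff coord_r
  proof
    fix n
    have K: "K n \<le> K (Suc n)" by (rule K_mono) simp
    have "\<rho> (Suc n) (w (Suc n)) \<le> \<rho> n (w n)" if "K (Suc n) = K n"
      unfolding \<rho>_def that using K_ge[of n] K_less[of "Suc n"] that
      by (intro rad_dec) (auto simp: S_Suc)
    moreover have "\<rho> n (w n) \<le> R s" if "K n = s" for n using \<rho>_bounds[of n "w n"] R_ge[of s] that by simp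
    ultimately show "v s w (Suc n) \<le> v s w n"
      using K R_nonneg[of s] \<rho>_bounds(1)[of n "w n"] by (auto simp: v_def less_imp_le)
  qed
  \<comment> \<open>As s grows, a coordinate in block k is 0 until s = k, then takes its selected
    radius, and from s = k + 1 on equals \<open>R s\<close>.\<close>
  have r_inc: "coord (r s w) n \<le> coord (r (Suc s) w) n" for s w n
  proof -
    have "\<rho> n (w n) \<le> R (Suc s)" if "K n = s"
      using \<rho>_bounds[of n "w n"] R_ge[of s] R_mono[of s] that by simp
    then show ?thesis
      using R_mono[of s] \<rho>_bounds(1)[of n "w n"] R_nonneg[of s]
      by (auto simp: coord_r v_def less_Suc_eq less_imp_le)
  qed
  have r_lim: "(\<lambda>s. coord (r s w) n) \<longlonglongrightarrow> 1" for w n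
  proof (rule Lim_transform_eventually[OF R_lim])
    show "\<forall>\<^sub>F s in sequentially. R s = coord (r s w) n"
      using eventually_gt_at_top[of "K n"] by eventually_elim (simp add: coord_r v_def)
  qed
  have F_lim: "AE w in torus_measure. (\<lambda>s. F (polar (r s w) w)) \<longlonglongrightarrow> 0"
    using good
  proof eventually_elim
    case (elim w)
    then have w: "w \<in> space torus_measure" ..
    have "\<forall>\<^sub>F s in sequentially. norm (F (polar (r s w) w)) \<le> exp (- real s)"
      using conjunct2[OF elim]
    proof eventually_elim
      case (elim s)
      have "real (N s) * (2 ^ s * real s) \<le> (\<Sum>j<N s. Re (H s j (rad s j (w (S s + j)) * w (S s + j))))"
        using elim by (simp add: good_def)
      then have "(1 / 2) ^ s / real (N s) * (real (N s) * (2 ^ s * real s)) \<le>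
          (1 / 2) ^ s / real (N s) * (\<Sum>j<N s. Re (H s j (rad s j (w (S s + j)) * w (S s + j))))"
        by (rule mult_left_mono) simp
      also have "(1 / 2) ^ s / real (N s) * (real (N s) * (2 ^ s * real s)) = real s"
        using N[of s] by (simp add: power_one_over)
      also have "(1 / 2) ^ s / real (N s) * (\<Sum>j<N s. Re (H s j (rad s j (w (S s + j)) * w (S s + j))))
          = (\<Sum>n\<in>{S s..<S (Suc s)}. a n * Re (h n (coord (polar (r s w) w) n)))"
        unfolding block_sum sum_distrib_left
        by (intro sum.cong refl) (simp add: a_S h_S coord_polar[OF w] coord_r v_def K_S \<rho>_S)
      finally have "exp (- (\<Sum>n\<in>{S s..<S (Suc s)}. a n * Re (h n (coord (polar (r s w) w) n)))) \<le> exp (- real s)"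
        by simp
      \<comment> \<open>Only block s is kept; the other blocks contribute nonnegative real parts and
        can only decrease the modulus of \<open>F\<close>.\<close>
      moreover have "norm (F (polar (r s w) w)) \<le>
          exp (- (\<Sum>n\<in>{S s..<S (Suc s)}. a n * Re (h n (coord (polar (r s w) w) n))))"
        by (rule norm_F_le[OF polar_in_ball[OF r_radii w]]) simp
      ultimately show ?case by linarith
    qed
    moreover have "(\<lambda>s. exp (- real s)) \<longlonglongrightarrow> 0" by real_asymp
    ultimately show ?case by (rule Lim_null_comparison)
  qed
  have "f w \<noteq> 0" for w by (simp add: f_def)
  then show ?thesis
    using f_in_Hinf holomorphic_extension_F r_meas r_dec r_inc r_lim F_lim
    by (intro exI[of _ f] exI[of _ F] exI[of _ r]) auto
qed

end
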